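(* Let $k \geq 3$ be an integer and let $L$ be a real number with $\frac{k}{2k-4}<L\leq \frac{k}{k-2}$. Then for all nonzero integers $n$, we have $M_k(n,L) \leq T$ and $$M_k(n)\leq (|n|^{2L}+n)^{1/k}+T+1,$$ where $$T=T(k,L)=\frac{3(\log 18-\log L)}{\log (k-1)-\log\left(3+\frac{k}{L}-k\right)}+12.$$
   Context: $\log$ is the natural logarithm. For an integer $k\ge 2$ and a nonzero integer $n$, a set $C$ of distinct positive integers has property $D_k(n)$ if $cc'+n$ is the $k$-th power of an integer for all distinct $c,c'\in C$. $M_k(n)=\sup\{|C|: C\subset\mathbb{N}\text{ has property }D_k(n)\}$ and, for real $L>0$, $M_k(n,L)=\sup\{|C\cap[|n|^L,\infty)|: C\subset\mathbb{N}\text{ has property }D_k(n)\}$. *)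

theory Defs
  imports "HOL-Analysis.Analysis"
begin

text \<open>The power is that of an integer, so for odd \<open>k\<close> negative values are admitted.\<close>

definition property_D :: "nat \<Rightarrow> int \<Rightarrow> nat set \<Rightarrow> bool" where
  "property_D k n C \<longleftrightarrow>
     (\<forall>c\<in>C. 0 < c) \<and>
     (\<forall>c\<in>C. \<forall>c'\<in>C. c \<noteq> c' \<longrightarrow> (\<exists>z::int. int c * int c' + n = z ^ k))"

text \<open>Since \<^const>\<open>card\<close> sends infinite sets to \<open>0\<close>, sizes are taken in \<^typ>\<open>enat\<close>;
  the suprema below are then genuine suprema and may be \<open>\<infinity>\<close>.\<close>

definition set_size :: "'a set \<Rightarrow> enat" where
  "set_size A = (if finite A then enat (card A) else \<infinity>)"

definition M :: "nat \<Rightarrow> int \<Rightarrow> enat" where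
  "M k n = (SUP C \<in> {C. property_D k n C}. set_size C)"

definition M_ge :: "nat \<Rightarrow> int \<Rightarrow> real \<Rightarrow> enat" where
  "M_ge k n L =
     (SUP C \<in> {C. property_D k n C}. set_size {c \<in> C. real_of_int \<bar>n\<bar> powr L \<le> real c})"

definition T :: "nat \<Rightarrow> real \<Rightarrow> real" where
  "T k L = 3 * (ln 18 - ln L) / (ln (real k - 1) - ln (3 + real k / L - real k)) + 12"

end

theory Submission
  imports Defs
begin

text \<open>
  Let \<open>a\<^sub>1 < a\<^sub>2 < \<dots>\<close> be the elements that are at least \<open>|n|\<^sup>L\<close>. For four of them, \<open>a < b < c < d\<close>, the products
  \<open>(ac + n)(bd + n)\<close> and \<open>(ad + n)(bc + n)\<close> are distinct \<open>k\<close>-th powers differing by \<open>n(b - a)(d - c)\<close>;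
  hence \<open>(ac)\<^sup>k\<^sup>-\<^sup>1 \<le> |n|\<^sup>k b d\<close>, a linear recurrence inequality for the logarithms, and more than
  \<open>T - 1\<close> elements would contain \<open>c \<ge> b\<^sup>2\<^sup>6\<close> and \<open>d \<ge> c\<^sup>1\<^sup>7\<close> with \<open>b = a\<^sub>4\<close>. Now \<open>c\<close> and \<open>d\<close> both give solutions of
  \<open>b x\<^sup>k - a y\<^sup>k = (b - a) n\<close> with \<open>a = a\<^sub>1\<close>, and the hypergeometric method of Thue and Siegel (Pade approximants
  to \<open>w\<^sup>1\<^sup>/\<^sup>k\<close> at the point defined by the first solution) excludes two solutions so far apart.

  For the elements below \<open>|n|\<^sup>L\<close>, multiplying by the largest one, \<open>e\<close>, gives distinct \<open>k\<close>-th powers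
  \<open>z\<^sup>k = e c + n\<close>. When \<open>k\<close> is odd and \<open>n < 0\<close>, negative \<open>z\<close> may occur, but all \<open>z\<^sup>k\<close> are congruent modulo \<open>e\<close>,
  which keeps the number of nonzero \<open>z\<close> at most \<open>max |z|\<close>; a possible \<open>z = 0\<close> is paid for by
  the \<open>1\<close> gained in \<open>T - 1\<close>.
\<close>

section \<open>Pade approximants to a power function\<close>

text \<open>With s = 3 + k/L - k, the logarithms u of the large elements satisfy u(i+3) >= (k-1)
  u(i+2) - u(i+1) + (2-s) u(i). The bounds on L say 1 <= s < k-1. So the coefficients add up to k-s
  > 1, and log(k-1) - log s, the denominator of T, measures the distance from the degenerate case s
  = k-1.

  The approximation argument needs b to be large, since constants such as 288 k^10 must be absorbed
  by powers of b. The fourth element suffices: the k-th powers formed from the first element and the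
  next three are distinct, which makes 3^k <= b^2.

  The exponent 26 gives F^2 \<eta>^3 <= 1, where F bounds the growth of the integer approximants and
  \<eta> the decay of the linear forms. Together, 26 and 17 win the last size comparison, which is
  tightest at k = 3.

  For k = 3 the growth estimates are also exceptional: discarding terms from the recurrence leaves
  ratio 1, so near s = 2 the growth has to come from the second differences of the
  logarithms.\<close>

lemma sum_binomial_reciprocal:
  fixes \<beta> :: real
  assumes "\<And>l. l \<le> g \<Longrightarrow> \<beta> + real l \<noteq> 0"
  shows "(\<Sum>l\<le>g. (-1) ^ l * real (g choose l) / (\<beta> + real l)) = fact g / pochhammer \<beta> (Suc g)"
  using assms
proof (induction g arbitrary: \<beta>)
  case 0
  then show ?case by simp
next
  case (Suc g)
  have nz: "\<beta> + real l \<noteq> 0" if "l \<le> Suc g" for l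
    using Suc.prems that by blast
  have nz1: "\<beta> + 1 + real l \<noteq> 0" if "l \<le> g" for l
    using nz[of "Suc l"] that by (simp add: algebra_simps)
  let ?f = "\<lambda>l. (-1) ^ l * real (g choose l) / (\<beta> + real l)"
  let ?h = "\<lambda>l. (-1) ^ l * real (g choose l) / (\<beta> + 1 + real l)"
  have S1: "sum ?f {..g} = fact g / pochhammer \<beta> (Suc g)"
    using Suc.IH[of \<beta>] nz by simp
  have S2: "sum ?h {..g} = fact g / pochhammer (\<beta> + 1) (Suc g)"
    using Suc.IH[of "\<beta> + 1"] nz1 by simp
  have e1: "sum ?f {..g} = 1 / \<beta> - (\<Sum>l\<le>g. (-1) ^ l * real (g choose Suc l) / (\<beta> + 1 + real l))"
  proof -
    have "sum ?f {..g} = sum ?f {..Suc g}" by simp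
    also have "\<dots> = 1 / \<beta> + (\<Sum>l\<le>g. ?f (Suc l))"
      by (subst sum.atMost_Suc_shift) simp
    also have "(\<Sum>l\<le>g. ?f (Suc l)) = - (\<Sum>l\<le>g. (-1) ^ l * real (g choose Suc l) / (\<beta> + 1 + real l))"
      by (simp add: sum_negf[symmetric] algebra_simps)
    finally show ?thesis by simp
  qed
  \<comment> \<open>Pascal's rule turns the sum for \<open>Suc g\<close> into the difference of the
    sums for \<open>g\<close> at \<open>\<beta>\<close> and at \<open>\<beta> + 1\<close>;
    \<open>e1\<close> is the matching reindexing.\<close>
  have "(\<Sum>l\<le>Suc g. (-1) ^ l * real (Suc g choose l) / (\<beta> + real l))
      = 1 / \<beta> - (\<Sum>l\<le>g. (-1) ^ l * real (Suc g choose Suc l) / (\<beta> + 1 + real l))"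
    by (subst sum.atMost_Suc_shift) (simp add: sum_negf[symmetric] add_ac del: binomial_Suc_Suc)
  also have "(\<Sum>l\<le>g. (-1) ^ l * real (Suc g choose Suc l) / (\<beta> + 1 + real l))
      = sum ?h {..g} + (\<Sum>l\<le>g. (-1) ^ l * real (g choose Suc l) / (\<beta> + 1 + real l))"
    by (simp add: sum.distrib[symmetric] ring_distribs add_divide_distrib)
  finally have "(\<Sum>l\<le>Suc g. (-1) ^ l * real (Suc g choose l) / (\<beta> + real l))
      = sum ?f {..g} - sum ?h {..g}"
    using e1 by simp
  also have "\<dots> = fact g / pochhammer \<beta> (Suc g) - fact g / pochhammer (\<beta> + 1) (Suc g)"
    by (simp only: S1 S2)
  also have "\<dots> = fact (Suc g) / pochhammer \<beta> (Suc (Suc g))"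
  proof -
    define p where "p = pochhammer (\<beta> + 1) g"
    have "p \<noteq> 0"
      unfolding p_def pochhammer_eq_0_iff
    proof clarify
      fix j assume "j < g" "\<beta> + 1 = - real j"
      then show False using nz1[of j] by simp
    qed
    define q where "q = \<beta> + 1 + real g"
    have "\<beta> \<noteq> 0" "q \<noteq> 0" using nz[of 0] nz1[of g] by (simp_all add: q_def)
    have "fact g / (\<beta> * p) - fact g / (p * q) = fact g * (q - \<beta>) / (\<beta> * (p * q))"
      using \<open>p \<noteq> 0\<close> \<open>\<beta> \<noteq> 0\<close> \<open>q \<noteq> 0\<close> by (simp add: field_simps)
    also have "fact g * (q - \<beta>) = fact (Suc g)"
      by (simp add: q_def algebra_simps)
    moreover have "pochhammer \<beta> (Suc g) = \<beta> * p"
      by (simp add: pochhammer_rec p_def)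
    moreover have "pochhammer (\<beta> + 1) (Suc g) = p * q"
      by (simp add: pochhammer_Suc p_def q_def)
    moreover have "pochhammer \<beta> (Suc (Suc g)) = \<beta> * (p * q)"
      by (subst pochhammer_rec) (simp add: pochhammer_Suc p_def q_def)
    ultimately show ?thesis by (simp only:)
  qed
  finally show ?case .
qed

text \<open>Coefficients of the Gauss polynomial 2F1(-g, \<alpha>-g; \<alpha>+1; w), scaled by
  \<open>(g + \<alpha>) gchoose g\<close>. So normalised they are positive, add up to a central
  binomial coefficient, and for \<alpha> = 1/k become integers after multiplication by
  \<open>k ^ (2 * g)\<close>. The reversed polynomial divided by the polynomial is the diagonal Pade
  approximant of w^\<alpha> at 1.\<close>

definition pade_coeff :: "real \<Rightarrow> nat \<Rightarrow> nat \<Rightarrow> real" where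
  "pade_coeff \<alpha> g i = ((real g - \<alpha>) gchoose i) * ((real g + \<alpha>) gchoose (g - i))"

definition pade_num :: "real \<Rightarrow> nat \<Rightarrow> real \<Rightarrow> real" where
  "pade_num \<alpha> g w = (\<Sum>i\<le>g. pade_coeff \<alpha> g i * w ^ i)"

definition pade_den :: "real \<Rightarrow> nat \<Rightarrow> real \<Rightarrow> real" where
  "pade_den \<alpha> g w = (\<Sum>i\<le>g. pade_coeff \<alpha> g i * w ^ (g - i))"

lemma frac_shift_nonzero:
  fixes \<alpha> :: real
  assumes "0 < \<alpha>" "\<alpha> < 1"
  shows "\<alpha> - real g + real j \<noteq> 0"
proof
  assume "\<alpha> - real g + real j = 0"
  then have "\<alpha> = real_of_int (int g - int j)" by simp
  with assms have "0 < int g - int j" "int g - int j < 1" by linarith+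
  then show False by linarith
qed

text \<open>The Pochhammer product splits into three blocks. The middle one, g + 1 factors starting
  at \<alpha>-g+i, cancels the denominator; the outer two are, up to signs and factorials, the two
  generalised binomials.\<close>

lemma pade_coeff_eq:
  fixes \<alpha> :: real
  assumes \<alpha>: "0 < \<alpha>" "\<alpha> < 1" and i: "i \<le> g"
  shows "pochhammer (\<alpha> - real g) (2 * g + 1) *
      ((-1) ^ (g - i) * real (g choose i) * (fact g / pochhammer (\<alpha> - real g + real i) (Suc g)))
    = (-1) ^ g * (fact g)\<^sup>2 * pade_coeff \<alpha> g i"
proof -
  define A where "A = pochhammer (\<alpha> - real g) i"
  define B where "B = pochhammer (\<alpha> - real g + real i) (Suc g)"
  define D where "D = pochhammer (\<alpha> + real i + 1) (g - i)"
  have Bnz: "B \<noteq> 0"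
    unfolding B_def pochhammer_eq_0_iff
  proof clarify
    fix j assume "\<alpha> - real g + real i = - real j"
    then show False using frac_shift_nonzero[OF \<alpha>, of g "i + j"] by simp
  qed
  have split: "pochhammer (\<alpha> - real g) (2 * g + 1) = A * B * D"
  proof -
    have "2 * g + 1 = i + (Suc g + (g - i))" using i by simp
    then show ?thesis
      by (simp only: pochhammer_product' A_def B_def D_def) (simp add: algebra_simps)
  qed
  have g1: "(real g - \<alpha>) gchoose i = (-1) ^ i * A / fact i"
    by (simp add: gbinomial_pochhammer A_def)
  have g2: "(real g + \<alpha>) gchoose (g - i) = D / fact (g - i)"
    using i by (simp add: gbinomial_pochhammer' D_def of_nat_diff algebra_simps)
  have c: "real (g choose i) = fact g / (fact i * fact (g - i))"
    using i by (simp add: binomial_fact)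
  have s: "(-1 :: real) ^ g * (-1) ^ i = (-1) ^ (g - i)"
  proof -
    have "g = (g - i) + i" using i by simp
    then have "(-1 :: real) ^ g * (-1) ^ i = (-1) ^ (g - i) * ((-1) ^ i * (-1) ^ i)"
      by (metis mult.assoc power_add)
    also have "(-1 :: real) ^ i * (-1) ^ i = 1" by (simp add: power_mult_distrib[symmetric])
    finally show ?thesis by simp
  qed
  have "(-1) ^ g * (fact g)\<^sup>2 * pade_coeff \<alpha> g i
      = ((-1) ^ g * (-1) ^ i) * (fact g)\<^sup>2 * A * D / (fact i * fact (g - i))"
    unfolding pade_coeff_def g1 g2 by simp
  also have "\<dots> = (-1) ^ (g - i) * (fact g)\<^sup>2 * A * D / (fact i * fact (g - i))"
    by (simp only: s)
  also have "\<dots> = A * B * D * ((-1) ^ (g - i) * real (g choose i) * (fact g / B))"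
    using Bnz by (simp add: c power2_eq_square)
  finally show ?thesis by (simp only: split B_def)
qed

text \<open>The factors pair up as (\<alpha>-j)(\<alpha>+j), of absolute value j^2 - \<alpha>^2 <=
  j^2, around the central factor \<alpha> < 1. Hence the normalisation by (g!)^2 costs nothing in
  the remainder.\<close>

lemma abs_pochhammer_symmetric_le:
  fixes \<alpha> :: real
  assumes "0 < \<alpha>" "\<alpha> < 1"
  shows "\<bar>pochhammer (\<alpha> - real g) (2 * g + 1)\<bar> \<le> (fact g)\<^sup>2"
proof (induction g)
  case 0
  then show ?case using assms by simp
next
  case (Suc g)
  have "pochhammer (\<alpha> - real (Suc g)) (2 * Suc g + 1)
      = (\<alpha> - real (Suc g)) * pochhammer (\<alpha> - real g) (Suc (2 * g + 1))"
    by (simp add: pochhammer_rec)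
  also have "pochhammer (\<alpha> - real g) (Suc (2 * g + 1))
      = pochhammer (\<alpha> - real g) (2 * g + 1) * (\<alpha> + real (Suc g))"
    by (subst pochhammer_Suc) (simp add: algebra_simps)
  finally have "\<bar>pochhammer (\<alpha> - real (Suc g)) (2 * Suc g + 1)\<bar>
      = \<bar>(\<alpha> - real (Suc g)) * (\<alpha> + real (Suc g))\<bar> * \<bar>pochhammer (\<alpha> - real g) (2 * g + 1)\<bar>"
    by (simp add: abs_mult)
  also have "\<bar>(\<alpha> - real (Suc g)) * (\<alpha> + real (Suc g))\<bar> = (real (Suc g))\<^sup>2 - \<alpha>\<^sup>2"
  proof -
    have "(\<alpha> - real (Suc g)) * (\<alpha> + real (Suc g)) = - ((real (Suc g))\<^sup>2 - \<alpha>\<^sup>2)"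
      by (simp add: power2_eq_square algebra_simps)
    moreover have "\<alpha>\<^sup>2 \<le> (real (Suc g))\<^sup>2"
      using assms by (intro power_mono) auto
    ultimately show ?thesis by simp
  qed
  also have "((real (Suc g))\<^sup>2 - \<alpha>\<^sup>2) * \<bar>pochhammer (\<alpha> - real g) (2 * g + 1)\<bar>
      \<le> (real (Suc g))\<^sup>2 * (fact g)\<^sup>2"
    by (intro mult_mono Suc.IH) auto
  also have "\<dots> = (fact (Suc g))\<^sup>2"
    by (simp add: power_mult_distrib)
  finally show ?case .
qed

text \<open>The remainder is \<open>\<Phi>(w) - \<Phi>(1)\<close> for a primitive \<open>\<Phi>\<close> of
  \<open>t \<mapsto> (1 - t)\<^sup>g (t - w)\<^sup>g t\<^sup>\<alpha>\<^sup>-\<^sup>g\<^sup>-\<^sup>1\<close>: integrating term by term gives multiples of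
  \<open>w\<^sup>\<alpha> pade_num\<close> and \<open>pade_den\<close>, and the mean value theorem bounds the difference.\<close>

lemma pade_remainder:
  fixes \<alpha> w :: real
  assumes \<alpha>: "0 < \<alpha>" "\<alpha> < 1" and w: "1 / 2 \<le> w"
  shows "\<bar>w powr \<alpha> * pade_num \<alpha> g w - pade_den \<alpha> g w\<bar> \<le> 2 * \<bar>1 - w\<bar> ^ (2 * g + 1)"
proof -
  define c where "c i l = (-1) ^ i * real (g choose i) * (real (g choose l) * (- w) ^ (g - l))" for i l
  define ex where "ex i l = \<alpha> - real g + real i + real l" for i l :: nat
  have exnz: "ex i l \<noteq> 0" for i l
    using frac_shift_nonzero[OF \<alpha>, of g "i + l"] by (simp add: ex_def)
  define \<Phi> where "\<Phi> t = (\<Sum>i\<le>g. \<Sum>l\<le>g. c i l * (t powr ex i l / ex i l))" for t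
  define D where "D t = (1 - t) ^ g * (t - w) ^ g * t powr (\<alpha> - real g - 1)" for t
  \<comment> \<open>The exponents \<open>ex i l\<close> run through \<alpha>-g, ..., \<alpha>+g.
    Their product \<open>\<Lambda>\<close> clears every denominator of the primitive.\<close>
  define \<Lambda> where "\<Lambda> = pochhammer (\<alpha> - real g) (2 * g + 1)"
  have deriv: "(\<Phi> has_real_derivative D t) (at t)" if t: "t > 0" for t
  proof -
    have "(\<Phi> has_real_derivative (\<Sum>i\<le>g. \<Sum>l\<le>g. c i l * (t powr (ex i l - 1)))) (at t)"
      unfolding \<Phi>_def using t exnz
      by (auto intro!: derivative_eq_intros simp: mult.commute)
    also have "(\<Sum>i\<le>g. \<Sum>l\<le>g. c i l * (t powr (ex i l - 1)))
       = (\<Sum>i\<le>g. \<Sum>l\<le>g. (real (g choose i) * (- t) ^ i) * (real (g choose l) * t ^ l * (- w) ^ (g - l))) * t powr (\<alpha> - real g - 1)"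
    proof -
      have "c i l * t powr (ex i l - 1) = (real (g choose i) * (- t) ^ i) *
          (real (g choose l) * t ^ l * (- w) ^ (g - l)) * t powr (\<alpha> - real g - 1)" for i l
      proof -
        have "t powr (ex i l - 1) = t powr (real i + real l + (\<alpha> - real g - 1))"
          by (simp add: ex_def algebra_simps)
        also have "\<dots> = t ^ i * t ^ l * t powr (\<alpha> - real g - 1)"
          using t by (simp only: powr_add powr_realpow)
        finally show ?thesis
          by (simp add: c_def power_minus[of t])
      qed
      then show ?thesis by (simp only: sum_distrib_right)
    qed
    also have "(\<Sum>i\<le>g. \<Sum>l\<le>g. (real (g choose i) * (- t) ^ i) * (real (g choose l) * t ^ l * (- w) ^ (g - l)))
       = (1 - t) ^ g * (t - w) ^ g"
    proof -
      have "(1 - t) ^ g = (\<Sum>i\<le>g. real (g choose i) * (- t) ^ i)"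
        using binomial_ring[of "- t" 1 g] by simp
      moreover have "(t - w) ^ g = (\<Sum>l\<le>g. real (g choose l) * t ^ l * (- w) ^ (g - l))"
        using binomial_ring[of t "- w" g] by simp
      ultimately show ?thesis by (simp add: sum_product)
    qed
    finally show ?thesis by (simp add: D_def)
  qed
  have w0: "w > 0" using w by simp
  have pf: "(\<Sum>l\<le>g. (-1) ^ l * real (g choose l) / (\<alpha> - real g + real i + real l))
      = fact g / pochhammer (\<alpha> - real g + real i) (Suc g)" for i
    using exnz by (intro sum_binomial_reciprocal) (auto simp: ex_def)
  have sgn: "(-1::real) ^ (g - l) = (-1) ^ g * (-1) ^ l" if "l \<le> g" for l
  proof -
    have "(-1::real) ^ g * (-1) ^ l = (-1) ^ (g - l) * ((-1) ^ l * (-1) ^ l)"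
      by (metis mult.assoc power_add le_add_diff_inverse2 that)
    then show ?thesis by (simp add: power_mult_distrib[symmetric])
  qed
  have Phiw: "\<Lambda> * \<Phi> w = (-1) ^ g * (fact g)\<^sup>2 * (w powr \<alpha> * pade_num \<alpha> g w)"
  proof -
    have summand: "c i l * (w powr ex i l / ex i l) =
        w powr \<alpha> * w ^ i * ((-1) ^ (g - i) * real (g choose i)) *
          ((-1) ^ l * real (g choose l) / (\<alpha> - real g + real i + real l))"
      if "i \<le> g" "l \<le> g" for i l
    proof -
      have "w powr ex i l = w powr (\<alpha> + real i - real (g - l))"
        using that by (simp add: ex_def of_nat_diff algebra_simps)
      also have "\<dots> = w powr \<alpha> * w ^ i / w ^ (g - l)"
        using w0 by (simp only: powr_add powr_diff powr_realpow)
      finally have "w ^ (g - l) * w powr ex i l = w powr \<alpha> * w ^ i"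
        using w0 by simp
      moreover have "c i l = (-1) ^ (g - i) * real (g choose i) * ((-1) ^ l * real (g choose l)) * w ^ (g - l)"
        using that by (simp add: c_def sgn power_minus[of w])
      ultimately show ?thesis by (simp add: ex_def mult_ac)
    qed
    have "\<Phi> w = (\<Sum>i\<le>g. w powr \<alpha> * w ^ i * ((-1) ^ (g - i) * real (g choose i)) *
        (fact g / pochhammer (\<alpha> - real g + real i) (Suc g)))"
    proof -
      have "\<Phi> w = (\<Sum>i\<le>g. \<Sum>l\<le>g. w powr \<alpha> * w ^ i * ((-1) ^ (g - i) * real (g choose i)) *
          ((-1) ^ l * real (g choose l) / (\<alpha> - real g + real i + real l)))"
        unfolding \<Phi>_def by (intro sum.cong refl summand) auto
      then show ?thesis by (simp only: sum_distrib_left[symmetric] pf)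
    qed
    then have "\<Lambda> * \<Phi> w = (\<Sum>i\<le>g. w powr \<alpha> * w ^ i * (\<Lambda> * ((-1) ^ (g - i) * real (g choose i) *
        (fact g / pochhammer (\<alpha> - real g + real i) (Suc g)))))"
      by (simp add: sum_distrib_left mult_ac)
    also have "\<dots> = (\<Sum>i\<le>g. w powr \<alpha> * w ^ i * ((-1) ^ g * (fact g)\<^sup>2 * pade_coeff \<alpha> g i))"
      unfolding \<Lambda>_def by (intro sum.cong refl) (subst pade_coeff_eq[OF \<alpha>], auto)
    finally show ?thesis
      by (simp add: pade_num_def sum_distrib_left mult_ac)
  qed
  \<comment> \<open>At t = 1 powers of w come only from expanding (t-w)^g, so the two indices
    exchange roles and the coefficients appear reversed.\<close>
  have Phi1: "\<Lambda> * \<Phi> 1 = (-1) ^ g * (fact g)\<^sup>2 * pade_den \<alpha> g w"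
  proof -
    have summand: "c i l * (1 powr ex i l / ex i l) =
        w ^ (g - l) * ((-1) ^ (g - l) * real (g choose l)) *
          ((-1) ^ i * real (g choose i) / (\<alpha> - real g + real l + real i))" for i l
      by (simp add: c_def ex_def power_minus[of w] mult_ac add_ac)
    have "\<Phi> 1 = (\<Sum>l\<le>g. \<Sum>i\<le>g. c i l * (1 powr ex i l / ex i l))"
      unfolding \<Phi>_def by (rule sum.swap)
    also have "\<dots> = (\<Sum>l\<le>g. w ^ (g - l) * ((-1) ^ (g - l) * real (g choose l)) *
        (fact g / pochhammer (\<alpha> - real g + real l) (Suc g)))"
      by (simp only: summand sum_distrib_left[symmetric] pf)
    finally have "\<Lambda> * \<Phi> 1 = (\<Sum>l\<le>g. w ^ (g - l) * (\<Lambda> * ((-1) ^ (g - l) * real (g choose l) *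
        (fact g / pochhammer (\<alpha> - real g + real l) (Suc g)))))"
      by (simp add: sum_distrib_left mult_ac)
    also have "\<dots> = (\<Sum>l\<le>g. w ^ (g - l) * ((-1) ^ g * (fact g)\<^sup>2 * pade_coeff \<alpha> g l))"
      unfolding \<Lambda>_def by (intro sum.cong refl) (subst pade_coeff_eq[OF \<alpha>], auto)
    finally show ?thesis
      by (simp add: pade_den_def sum_distrib_left mult_ac)
  qed
  \<comment> \<open>Both 1-\<xi> and (\<xi>-w)/\<xi> are at most |1-w| in absolute value, which
    disposes of the g-fold pole. The rest, \<xi>^(\<alpha>-1) with \<xi> > 1/2, gives the constant
    2.\<close>
  have Dbound: "\<bar>D \<xi>\<bar> \<le> 2 * \<bar>1 - w\<bar> ^ (2 * g)" if \<xi>: "w < \<xi> \<and> \<xi> < 1 \<or> 1 < \<xi> \<and> \<xi> < w" for \<xi>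
  proof -
    have x0: "\<xi> > 1 / 2" using \<xi> w by auto
    have "\<xi> powr (\<alpha> - real g - 1) = \<xi> powr (\<alpha> - 1) / \<xi> ^ g"
      using x0 by (simp add: powr_diff powr_realpow powr_one)
    then have "\<bar>D \<xi>\<bar> = \<bar>(1 - \<xi>) * ((\<xi> - w) / \<xi>)\<bar> ^ g * \<xi> powr (\<alpha> - 1)"
      using x0 by (simp add: D_def abs_mult power_abs power_mult_distrib power_divide)
    also have "\<dots> \<le> (\<bar>1 - w\<bar>\<^sup>2) ^ g * 2"
    proof (intro mult_mono power_mono)
      have "\<bar>1 - \<xi>\<bar> \<le> \<bar>1 - w\<bar>" using \<xi> by auto
      moreover have "\<bar>(\<xi> - w) / \<xi>\<bar> \<le> \<bar>1 - w\<bar>"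
      proof (cases "w < 1")
        case True
        then have "w < \<xi>" "\<xi> < 1" using \<xi> by auto
        then have "(\<xi> - w) / \<xi> \<le> 1 - w" using x0 w0
          by (simp add: field_simps)
        moreover have "0 \<le> (\<xi> - w) / \<xi>" using x0 \<open>w < \<xi>\<close> by simp
        ultimately show ?thesis by simp
      next
        case False
        then have "1 < \<xi>" "\<xi> < w" using \<xi> by auto
        then have "\<bar>(\<xi> - w) / \<xi>\<bar> = (w - \<xi>) / \<xi>" by (simp add: abs_divide)
        also have "\<dots> \<le> (w - \<xi>) / 1" using \<open>1 < \<xi>\<close> \<open>\<xi> < w\<close> by (intro divide_left_mono) auto
        also have "\<dots> \<le> \<bar>1 - w\<bar>" using \<open>1 < \<xi>\<close> \<open>\<xi> < w\<close> by simp
        finally show ?thesis .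
      qed
      ultimately show "\<bar>(1 - \<xi>) * ((\<xi> - w) / \<xi>)\<bar> \<le> \<bar>1 - w\<bar>\<^sup>2"
        unfolding abs_mult power2_eq_square by (intro mult_mono) auto
      have "\<xi> powr (\<alpha> - 1) \<le> (1 / 2) powr (\<alpha> - 1)"
        using x0 \<alpha> by (intro powr_mono2') auto
      also have "\<dots> = 2 powr (1 - \<alpha>)"
        by (simp add: powr_divide powr_diff)
      also have "\<dots> \<le> 2 powr 1" using \<alpha> by (intro powr_mono) auto
      finally show "\<xi> powr (\<alpha> - 1) \<le> 2" by simp
    qed auto
    finally show ?thesis by (simp add: power_mult)
  qed
  have diff: "\<bar>\<Phi> w - \<Phi> 1\<bar> \<le> 2 * \<bar>1 - w\<bar> ^ (2 * g + 1)"
  proof -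
    consider "w < 1" | "w = 1" | "w > 1" by linarith
    then show ?thesis
    proof cases
      case 1
      obtain \<xi> where "w < \<xi>" "\<xi> < 1" and e: "\<Phi> 1 - \<Phi> w = (1 - w) * D \<xi>"
        using MVT2[OF 1, of \<Phi> D] deriv w0 by auto
      then have "\<bar>D \<xi>\<bar> \<le> 2 * \<bar>1 - w\<bar> ^ (2 * g)" using Dbound by blast
      then have "\<bar>1 - w\<bar> * \<bar>D \<xi>\<bar> \<le> \<bar>1 - w\<bar> * (2 * \<bar>1 - w\<bar> ^ (2 * g))"
        by (intro mult_left_mono) auto
      moreover have "\<bar>\<Phi> w - \<Phi> 1\<bar> = \<bar>1 - w\<bar> * \<bar>D \<xi>\<bar>"
        using e by (metis abs_minus_commute abs_mult)
      ultimately show ?thesis by (simp add: mult_ac)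
    next
      case 2
      then show ?thesis by simp
    next
      case 3
      obtain \<xi> where "1 < \<xi>" "\<xi> < w" and e: "\<Phi> w - \<Phi> 1 = (w - 1) * D \<xi>"
        using MVT2[OF 3, of \<Phi> D] deriv by auto
      then have "\<bar>D \<xi>\<bar> \<le> 2 * \<bar>1 - w\<bar> ^ (2 * g)" using Dbound by blast
      then have "\<bar>1 - w\<bar> * \<bar>D \<xi>\<bar> \<le> \<bar>1 - w\<bar> * (2 * \<bar>1 - w\<bar> ^ (2 * g))"
        by (intro mult_left_mono) auto
      moreover have "\<bar>\<Phi> w - \<Phi> 1\<bar> = \<bar>1 - w\<bar> * \<bar>D \<xi>\<bar>"
        using e by (metis abs_minus_commute abs_mult)
      ultimately show ?thesis by (simp add: mult_ac)
    qed
  qed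
  have "(fact g)\<^sup>2 * \<bar>w powr \<alpha> * pade_num \<alpha> g w - pade_den \<alpha> g w\<bar> = \<bar>\<Lambda> * \<Phi> w - \<Lambda> * \<Phi> 1\<bar>"
    unfolding Phiw Phi1 by (simp add: right_diff_distrib[symmetric] abs_mult power_abs)
  also have "\<dots> = \<bar>\<Lambda>\<bar> * \<bar>\<Phi> w - \<Phi> 1\<bar>"
    by (simp add: right_diff_distrib[symmetric] abs_mult)
  also have "\<dots> \<le> (fact g)\<^sup>2 * (2 * \<bar>1 - w\<bar> ^ (2 * g + 1))"
    using abs_pochhammer_symmetric_le[OF \<alpha>, of g] diff unfolding \<Lambda>_def
    by (intro mult_mono) auto
  finally show ?thesis by simp
qed

section \<open>Positivity, size and denominators of the coefficients\<close>

lemma pade_coeff_pos: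
  assumes "0 < \<alpha>" "\<alpha> < 1" "i \<le> g"
  shows "0 < pade_coeff \<alpha> g i"
proof -
  have "0 < pochhammer (real g - \<alpha> - real i + 1) i" "0 < pochhammer (real g + \<alpha> - real (g - i) + 1) (g - i)"
    using assms by (auto intro!: pochhammer_pos simp: of_nat_diff)
  then show ?thesis by (simp add: pade_coeff_def gbinomial_pochhammer')
qed

lemma sum_pade_coeff: "(\<Sum>i\<le>g. pade_coeff \<alpha> g i) = real ((2 * g) choose g)"
proof -
  have "(\<Sum>i\<le>g. pade_coeff \<alpha> g i) = ((real g - \<alpha>) + (real g + \<alpha>)) gchoose g"
    using gbinomial_Vandermonde[of "real g - \<alpha>" "real g + \<alpha>" g]
    by (simp add: pade_coeff_def atLeast0AtMost)
  also have "(real g - \<alpha>) + (real g + \<alpha>) = real (2 * g)" by simp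
  finally show ?thesis by (simp only: binomial_gbinomial)
qed

lemma sum_pade_coeff_le: "(\<Sum>i\<le>g. pade_coeff \<alpha> g i) \<le> 4 ^ g"
proof -
  have "(2 * g) choose g \<le> 2 ^ (2 * g)" by (rule binomial_le_pow2)
  then have "real ((2 * g) choose g) \<le> real (2 ^ (2 * g))" by (rule of_nat_mono)
  then show ?thesis by (simp add: sum_pade_coeff power_mult)
qed

text \<open>Comparing coefficients in \<open>(1 + x)\<^sup>1 = ((1 + x)\<^sup>1\<^sup>/\<^sup>k)\<^sup>k\<close> isolates \<open>k\<close> times the top coefficient;
  all other products have at least two factors from lower degrees, each divisible by \<open>k\<close> after scaling.\<close>

lemma gbinomial_root_integral:
  fixes k :: nat
  assumes k: "k > 0" and i: "i > 0"
  shows "\<exists>z::int. real k ^ (2 * i) * ((real j / real k) gchoose i) = real k * of_int z"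
  using i
proof (induction i arbitrary: j rule: less_induct)
  case (less i)
  define G where "G j i = real k ^ (2 * i) * ((real j / real k) gchoose i)" for j i
  have IH: "\<exists>z::int. G j l = real k * of_int z" if "0 < l" "l < i" for j l
    unfolding G_def using less.IH that by blast
  \<comment> \<open>By Vandermonde for (j+1)/k = j/k + 1/k, the step from j to j+1 adds
    \<open>G 1 i\<close> modulo k^2.\<close>
  have lin: "\<exists>z::int. G j i = real j * G 1 i + (real k)\<^sup>2 * of_int z" for j
  proof (induction j)
    case 0
    have "G 0 i = 0" using less.prems by (simp add: G_def gbinomial_0_left)
    then show ?case by (intro exI[of _ 0]) simp
  next
    case (Suc j)
    then obtain z :: int where z: "G j i = real j * G 1 i + (real k)\<^sup>2 * of_int z" by blast
    have "(real (Suc j) / real k) gchoose i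
        = (\<Sum>l\<in>{0..i}. ((real j / real k) gchoose l) * ((real 1 / real k) gchoose (i - l)))"
      by (subst gbinomial_Vandermonde) (simp add: add_divide_distrib add.commute)
    then have "G (Suc j) i = (\<Sum>l\<in>{0..i}. real k ^ (2 * i) *
        (((real j / real k) gchoose l) * ((real 1 / real k) gchoose (i - l))))"
      by (simp add: G_def sum_distrib_left)
    also have "\<dots> = (\<Sum>l\<in>{0..i}. G j l * G 1 (i - l))"
    proof (intro sum.cong refl)
      fix l assume "l \<in> {0..i}"
      then have "real k ^ (2 * i) = real k ^ (2 * l) * real k ^ (2 * (i - l))"
        by (simp add: power_add[symmetric] flip: distrib_left)
      then show "real k ^ (2 * i) * (((real j / real k) gchoose l) * ((real 1 / real k) gchoose (i - l)))
          = G j l * G 1 (i - l)"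
        by (simp add: G_def)
    qed
    also have "{0..i} = insert 0 (insert i {0<..<i})" using less.prems by auto
    also have "(\<Sum>l\<in>insert 0 (insert i {0<..<i}). G j l * G 1 (i - l))
        = G 1 i + (G j i + (\<Sum>l\<in>{0<..<i}. G j l * G 1 (i - l)))"
      using less.prems by (subst sum.insert; simp)+ (simp add: G_def)
    finally have e: "G (Suc j) i = G 1 i + G j i + (\<Sum>l\<in>{0<..<i}. G j l * G 1 (i - l))"
      by simp
    have "\<exists>z::int. G j l * G 1 (i - l) = (real k)\<^sup>2 * of_int z" if l: "l \<in> {0<..<i}" for l
    proof -
      obtain z1 z2 :: int where "G j l = real k * of_int z1" "G 1 (i - l) = real k * of_int z2"
        using IH[of l j] IH[of "i - l" 1] l by auto
      then show ?thesis by (intro exI[of _ "z1 * z2"]) (simp add: power2_eq_square)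
    qed
    then obtain f :: "nat \<Rightarrow> int" where
      f: "\<And>l. l \<in> {0<..<i} \<Longrightarrow> G j l * G 1 (i - l) = (real k)\<^sup>2 * of_int (f l)" by metis
    have "(\<Sum>l\<in>{0<..<i}. G j l * G 1 (i - l)) = (real k)\<^sup>2 * of_int (\<Sum>l\<in>{0<..<i}. f l)"
      unfolding of_int_sum sum_distrib_left by (intro sum.cong refl f)
    then have "G (Suc j) i = real (Suc j) * G 1 i + (real k)\<^sup>2 * of_int (z + (\<Sum>l\<in>{0<..<i}. f l))"
      using e z by (simp add: algebra_simps)
    then show ?case by blast
  qed
  have G1: "\<exists>z::int. G 1 i = real k * of_int z"
  proof -
    \<comment> \<open>At j = k the binomial is the ordinary \<open>1 choose i\<close>, so
      \<open>G k i\<close> is a multiple of k^2, and therefore \<open>k * G 1 i\<close> is one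
      too.\<close>
    obtain z :: int where z: "G k i = real k * G 1 i + (real k)\<^sup>2 * of_int z" using lin by blast
    have "G k i = real k ^ (2 * i) * real (1 choose i)"
      using k by (simp add: G_def binomial_gbinomial)
    also have "real k ^ (2 * i) = (real k)\<^sup>2 * real k ^ (2 * (i - 1))"
      using less.prems by (cases i) (simp_all add: power2_eq_square)
    finally have "real k * G 1 i = real k * (real k * of_int (int (k ^ (2 * (i - 1)) * (1 choose i)) - z))"
      using z by (simp add: power2_eq_square algebra_simps)
    then show ?thesis using k by (metis mult_cancel_left of_nat_eq_0_iff not_gr_zero)
  qed
  then obtain y :: int where y: "G 1 i = real k * of_int y" by blast
  obtain z :: int where "G j i = real j * G 1 i + (real k)\<^sup>2 * of_int z" using lin by blast
  then have "G j i = real k * of_int (int j * y + int k * z)"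
    unfolding y by (simp add: power2_eq_square algebra_simps)
  then show ?case unfolding G_def by blast
qed

lemma gbinomial_root_in_Ints:
  fixes k :: nat
  assumes "k > 0"
  shows "real k ^ (2 * i) * ((real j / real k) gchoose i) \<in> \<int>"
proof (cases "i = 0")
  case False
  then obtain z :: int where "real k ^ (2 * i) * ((real j / real k) gchoose i) = real k * of_int z"
    using gbinomial_root_integral assms by blast
  then show ?thesis by simp
qed simp

lemma pade_coeff_integral:
  assumes k: "k > 0" and i: "i \<le> g"
  shows "real k ^ (2 * g) * pade_coeff (1 / real k) g i \<in> \<int>"
proof (cases "g = 0")
  \<comment> \<open>Set apart because the natural number \<open>g * k - 1\<close> used below would
    be truncated at g = 0.\<close>
  case True
  then show ?thesis using i by (simp add: pade_coeff_def)
next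
  case False
  have "1 \<le> g * k" using False k by (cases g; cases k) auto
  then have "real g - 1 / real k = real (g * k - 1) / real k"
    using k by (simp add: of_nat_diff field_simps)
  moreover have "real g + 1 / real k = real (g * k + 1) / real k"
    using k by (simp add: field_simps)
  moreover have "real k ^ (2 * g) = real k ^ (2 * i) * real k ^ (2 * (g - i))"
    using i by (simp add: power_add[symmetric] flip: distrib_left)
  ultimately have "real k ^ (2 * g) * pade_coeff (1 / real k) g i =
      (real k ^ (2 * i) * ((real (g * k - 1) / real k) gchoose i)) *
      (real k ^ (2 * (g - i)) * ((real (g * k + 1) / real k) gchoose (g - i)))"
    by (simp only: pade_coeff_def mult_ac)
  then show ?thesis using gbinomial_root_in_Ints[OF k] by (metis Ints_mult)
qed

text \<open>Remove the exact power (w-1)^r. If r < N, the cofactor is bounded near 1 by a positive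
  power of |1-w|, so by continuity it vanishes at 1, contradicting the choice of r.\<close>

lemma linear_power_dvd_if_bounded:
  fixes p :: "real poly"
  assumes "\<And>w. 1 / 2 \<le> w \<Longrightarrow> w \<le> 3 / 2 \<Longrightarrow> \<bar>poly p w\<bar> \<le> K * \<bar>1 - w\<bar> ^ N"
  shows "[:-1, 1:] ^ N dvd p"
proof (cases "p = 0")
  case False
  define r where "r = order 1 p"
  obtain q where pq: "p = [:-1, 1:] ^ r * q" and q: "\<not> [:-1, 1:] dvd q"
    using order_decomp[OF False, of 1] unfolding r_def by auto
  have "N \<le> r"
  proof (rule ccontr)
    assume "\<not> N \<le> r"
    have bd: "\<bar>poly q w\<bar> \<le> K * \<bar>1 - w\<bar> ^ (N - r)" if w: "1 / 2 \<le> w" "w \<le> 3 / 2" "w \<noteq> 1" for w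
    proof -
      have "\<bar>1 - w\<bar> ^ r * \<bar>poly q w\<bar> = \<bar>poly p w\<bar>"
        by (simp add: pq abs_mult power_abs abs_minus_commute)
      also have "\<dots> \<le> K * \<bar>1 - w\<bar> ^ N" using assms w by blast
      also have "\<dots> = \<bar>1 - w\<bar> ^ r * (K * \<bar>1 - w\<bar> ^ (N - r))"
        using \<open>\<not> N \<le> r\<close> by (simp add: power_add[symmetric])
      finally show ?thesis using w by simp
    qed
    have "((\<lambda>w. K * \<bar>1 - w\<bar> ^ (N - r)) \<longlongrightarrow> K * \<bar>1 - 1\<bar> ^ (N - r)) (at 1)"
      by (intro tendsto_intros)
    then have "((\<lambda>w. K * \<bar>1 - w\<bar> ^ (N - r)) \<longlongrightarrow> 0) (at 1)"
      using \<open>\<not> N \<le> r\<close> by (simp add: power_0_left)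
    moreover have "eventually (\<lambda>w. norm (poly q w) \<le> K * \<bar>1 - w\<bar> ^ (N - r)) (at 1)"
    proof -
      have "eventually (\<lambda>w::real. w \<in> {1/2<..<3/2}) (nhds 1)"
        by (intro eventually_nhds_in_open) auto
      then show ?thesis
        unfolding eventually_at_filter by eventually_elim (use bd in auto)
    qed
    ultimately have "(poly q \<longlongrightarrow> 0) (at 1)"
      by (rule Lim_null_comparison[rotated])
    moreover have "(poly q \<longlongrightarrow> poly q 1) (at 1)"
      by (intro tendsto_poly tendsto_ident_at)
    ultimately have "poly q 1 = 0" using LIM_unique by blast
    with q show False by (simp add: poly_eq_0_iff_dvd)
  qed
  then show ?thesis unfolding pq by (meson dvd_mult2 le_imp_power_dvd)
qed simp

text \<open>The determinant has degree at most \<open>2g + 1\<close> and vanishes to order \<open>2g + 1\<close> at \<open>1\<close>, so it is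
  a multiple of \<open>(w - 1)\<^sup>2\<^sup>g\<^sup>+\<^sup>1\<close>; its value at \<open>0\<close> is not zero.\<close>

lemma pade_determinant_nonzero:
  fixes \<alpha> w :: real
  assumes \<alpha>: "0 < \<alpha>" "\<alpha> < 1" and w: "w \<noteq> 1"
  shows "pade_num \<alpha> g w * pade_den \<alpha> (Suc g) w \<noteq> pade_num \<alpha> (Suc g) w * pade_den \<alpha> g w"
proof -
  define pn where "pn g = (\<Sum>i\<le>g. monom (pade_coeff \<alpha> g i) i)" for g
  define pd where "pd g = (\<Sum>i\<le>g. monom (pade_coeff \<alpha> g i) (g - i))" for g
  have pn: "poly (pn g) v = pade_num \<alpha> g v" for g v
    by (simp add: pn_def pade_num_def poly_sum poly_monom)
  have pd: "poly (pd g) v = pade_den \<alpha> g v" for g v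
    by (simp add: pd_def pade_den_def poly_sum poly_monom)
  have dn: "degree (pn g) \<le> g" for g
    unfolding pn_def by (intro degree_sum_le) (auto intro: order.trans[OF degree_monom_le])
  have dd: "degree (pd g) \<le> g" for g
    unfolding pd_def by (intro degree_sum_le) (auto intro: order.trans[OF degree_monom_le])
  define D where "D = pn g * pd (Suc g) - pn (Suc g) * pd g"
  have degD: "degree D \<le> 2 * g + 1"
    unfolding D_def
    by (intro degree_diff_le order.trans[OF degree_mult_le])
       (use dn[of g] dd[of "Suc g"] dn[of "Suc g"] dd[of g] in auto)
  have "\<exists>K. \<forall>v. 1 / 2 \<le> v \<and> v \<le> 3 / 2 \<longrightarrow> \<bar>poly D v\<bar> \<le> K * \<bar>1 - v\<bar> ^ (2 * g + 1)"
  proof -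
    obtain A where A: "\<And>v. v \<in> {1/2..3/2} \<Longrightarrow> norm (poly (pn g) v) \<le> A"
      using compact_imp_bounded[OF compact_continuous_image[OF continuous_on_poly[OF continuous_on_id] compact_Icc]]
      unfolding bounded_iff by (metis imageI)
    obtain B where B: "\<And>v. v \<in> {1/2..3/2} \<Longrightarrow> norm (poly (pn (Suc g)) v) \<le> B"
      using compact_imp_bounded[OF compact_continuous_image[OF continuous_on_poly[OF continuous_on_id] compact_Icc]]
      unfolding bounded_iff by (metis imageI)
    have "\<bar>poly D v\<bar> \<le> (2 * \<bar>A\<bar> + 2 * \<bar>B\<bar>) * \<bar>1 - v\<bar> ^ (2 * g + 1)"
      if v: "1 / 2 \<le> v" "v \<le> 3 / 2" for v
    proof -
      let ?e = "\<bar>1 - v\<bar> ^ (2 * g + 1)"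
      define R where "R g = v powr \<alpha> * pade_num \<alpha> g v - pade_den \<alpha> g v" for g
      have R1: "\<bar>R g\<bar> \<le> 2 * ?e" unfolding R_def by (rule pade_remainder[OF \<alpha> v(1)])
      have "\<bar>R (Suc g)\<bar> \<le> 2 * \<bar>1 - v\<bar> ^ (2 * Suc g + 1)" unfolding R_def by (rule pade_remainder[OF \<alpha> v(1)])
      also have "\<dots> \<le> 2 * ?e" using v by (intro mult_left_mono power_decreasing) auto
      finally have R2: "\<bar>R (Suc g)\<bar> \<le> 2 * ?e" .
      \<comment> \<open>The terms with \<open>v powr \<alpha>\<close> cancel: the determinant
        combines two remainders and inherits their order of vanishing.\<close>
      have "poly D v = poly (pn (Suc g)) v * R g - poly (pn g) v * R (Suc g)"
        by (simp add: D_def pn pd R_def algebra_simps)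
      then have "\<bar>poly D v\<bar> \<le> \<bar>poly (pn (Suc g)) v\<bar> * \<bar>R g\<bar> + \<bar>poly (pn g) v\<bar> * \<bar>R (Suc g)\<bar>"
        by (metis abs_mult abs_triangle_ineq4)
      also have "\<dots> \<le> \<bar>B\<bar> * (2 * ?e) + \<bar>A\<bar> * (2 * ?e)"
        using A[of v] B[of v] v R1 R2
        by (intro add_mono mult_mono) auto
      finally show ?thesis by (simp add: algebra_simps)
    qed
    then show ?thesis by blast
  qed
  then obtain K where "\<And>v. 1 / 2 \<le> v \<Longrightarrow> v \<le> 3 / 2 \<Longrightarrow> \<bar>poly D v\<bar> \<le> K * \<bar>1 - v\<bar> ^ (2 * g + 1)"
    by blast
  then have "[:-1, 1:] ^ (2 * g + 1) dvd D" by (rule linear_power_dvd_if_bounded)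
  then obtain r where r: "D = [:-1, 1:] ^ (2 * g + 1) * r" by blast
  have D0: "poly D 0 \<noteq> 0"
  proof -
    have n0: "pade_num \<alpha> g 0 = ((real g + \<alpha>) gchoose g)" for g
      unfolding pade_num_def
      by (subst sum.remove[of _ 0]) (auto simp: pade_coeff_def intro!: sum.neutral)
    have d0: "pade_den \<alpha> g 0 = ((real g - \<alpha>) gchoose g)" for g
      unfolding pade_den_def
      by (subst sum.remove[of _ g]) (auto simp: pade_coeff_def intro!: sum.neutral)
    \<comment> \<open>Absorption reduces both binomials at level g+1 to level g, so that the value
      at 0 is a positive product times the difference of two explicit factors.\<close>
    have up: "(real (Suc g) + x) gchoose (Suc g) = (real (Suc g) + x) / real (Suc g) * ((real g + x) gchoose g)" for x
      using gbinomial_absorption[of g "real (Suc g) + x"] by (simp add: field_simps)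
    have p1: "(real g + \<alpha>) gchoose g > 0" "(real g - \<alpha>) gchoose g > 0"
      using \<alpha> by (auto simp: gbinomial_pochhammer' intro!: divide_pos_pos pochhammer_pos)
    have "poly D 0 = ((real g + \<alpha>) gchoose g) * ((real (Suc g) + - \<alpha>) gchoose (Suc g)) -
        ((real (Suc g) + \<alpha>) gchoose (Suc g)) * ((real g + - \<alpha>) gchoose g)"
      by (simp add: D_def pn pd n0 d0)
    also have "\<dots> = ((real g + \<alpha>) gchoose g) * ((real g + - \<alpha>) gchoose g) * (- 2 * \<alpha> / real (Suc g))"
    proof -
      have "(real (Suc g) + - \<alpha>) / real (Suc g) - (real (Suc g) + \<alpha>) / real (Suc g) = - 2 * \<alpha> / real (Suc g)"
        by (simp only: diff_divide_distrib[symmetric]) simp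
      moreover have "x * (u * y) - v * x * y = x * y * (u - v)" for x y u v :: real
        by (simp add: algebra_simps)
      ultimately show ?thesis unfolding up by (simp only:)
    qed
    finally show ?thesis using p1 \<alpha> by simp
  qed
  then have r0: "r \<noteq> 0" using r by auto
  have "degree D = (2 * g + 1) + degree r"
    unfolding r using r0 by (subst degree_mult_eq) (simp_all add: degree_power_eq del: power_Suc)
  then have "degree r = 0" using degD by simp
  then obtain c where c: "r = [:c:]" by (metis degree_0_id)
  then have "c \<noteq> 0" using r0 by auto
  then have "poly D w \<noteq> 0" using w by (simp add: r c)
  then show ?thesis by (simp add: D_def pn pd)
qed

section \<open>Two distant solutions of a binomial Thue equation\<close>

text \<open>Multiplying both approximants at w = U/V by k^(2g) V^g clears all denominators. The 4
  comes from the bound 4^g for the coefficient sum, and V <= 2U is the condition w >= 1/2 of the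
  remainder estimate.\<close>

lemma pade_integer_forms:
  fixes k U V :: nat and W :: real
  assumes k: "k \<ge> 2" and U: "U > 0" and UV: "U \<noteq> V" and V: "V > 0" "V \<le> 2 * U"
    and W: "real U \<le> W" "real V \<le> W"
  obtains P Q :: "nat \<Rightarrow> int" where
    "\<And>g. 0 \<le> P g" "\<And>g. real_of_int (P g) \<le> (4 * (real k)\<^sup>2 * W) ^ g"
    "\<And>g. \<bar>(real U / real V) powr (1 / real k) * P g - Q g\<bar>
        \<le> 2 * \<bar>1 - real U / real V\<bar> * ((real k)\<^sup>2 * real V * (1 - real U / real V)\<^sup>2) ^ g"
    "\<And>g. P g * Q (Suc g) \<noteq> P (Suc g) * Q g"
proof -
  define \<alpha> where "\<alpha> = 1 / real k"
  define w where "w = real U / real V"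
  have \<alpha>: "0 < \<alpha>" "\<alpha> < 1" using k by (auto simp: \<alpha>_def)
  have "real V \<le> 2 * real U" using V(2) by (metis of_nat_mono of_nat_mult of_nat_numeral)
  then have w: "1 / 2 \<le> w" using V by (simp add: w_def field_simps)
  have w1: "w \<noteq> 1" using UV V by (simp add: w_def)
  define h where "h g i = real k ^ (2 * g) * pade_coeff \<alpha> g i" for g i
  have h0: "0 \<le> h g i" if "i \<le> g" for g i
    using pade_coeff_pos[OF \<alpha> that] by (simp add: h_def)
  define Pt where "Pt g = (\<Sum>i\<le>g. h g i * (real U ^ i * real V ^ (g - i)))" for g
  define Qt where "Qt g = (\<Sum>i\<le>g. h g i * (real U ^ (g - i) * real V ^ i))" for g
  have hI: "h g i \<in> \<int>" if "i \<le> g" for g i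
    unfolding h_def \<alpha>_def using pade_coeff_integral that k by auto
  have "Pt g \<in> \<int>" "Qt g \<in> \<int>" for g
    unfolding Pt_def Qt_def using hI by (auto intro!: Ints_sum Ints_mult Ints_power)
  then have "\<forall>g. \<exists>z. Pt g = of_int z" "\<forall>g. \<exists>z. Qt g = of_int z" by (meson Ints_cases)+
  then obtain P Q :: "nat \<Rightarrow> int" where P: "\<And>g. real_of_int (P g) = Pt g"
    and Q: "\<And>g. real_of_int (Q g) = Qt g" by metis
  have Pw: "Pt g = real k ^ (2 * g) * real V ^ g * pade_num \<alpha> g w" for g
    unfolding Pt_def pade_num_def sum_distrib_left
  proof (intro sum.cong refl)
    fix i assume "i \<in> {..g}"
    then have "real V ^ g = real V ^ i * real V ^ (g - i)" by (simp add: power_add[symmetric])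
    then show "h g i * (real U ^ i * real V ^ (g - i)) =
        real k ^ (2 * g) * real V ^ g * (pade_coeff \<alpha> g i * w ^ i)"
      using V by (simp add: h_def w_def power_divide)
  qed
  have Qw: "Qt g = real k ^ (2 * g) * real V ^ g * pade_den \<alpha> g w" for g
    unfolding Qt_def pade_den_def sum_distrib_left
  proof (intro sum.cong refl)
    fix i assume "i \<in> {..g}"
    then have "real V ^ g = real V ^ i * real V ^ (g - i)" by (simp add: power_add[symmetric])
    then show "h g i * (real U ^ (g - i) * real V ^ i) =
        real k ^ (2 * g) * real V ^ g * (pade_coeff \<alpha> g i * w ^ (g - i))"
      using V by (simp add: h_def w_def power_divide)
  qed
  show thesis
  proof
    fix g
    have "0 \<le> Pt g" unfolding Pt_def using h0 by (intro sum_nonneg) auto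
    then show "0 \<le> P g" using P[of g] by simp
    have "Pt g \<le> (\<Sum>i\<le>g. h g i * W ^ g)"
      unfolding Pt_def
    proof (intro sum_mono mult_left_mono)
      fix i assume i: "i \<in> {..g}"
      have "real U ^ i * real V ^ (g - i) \<le> W ^ i * W ^ (g - i)"
        using W by (intro mult_mono power_mono) auto
      then show "real U ^ i * real V ^ (g - i) \<le> W ^ g" using i by (simp add: power_add[symmetric])
    qed (use h0 in auto)
    also have "\<dots> = real k ^ (2 * g) * W ^ g * (\<Sum>i\<le>g. pade_coeff \<alpha> g i)"
      by (simp add: h_def sum_distrib_left sum_distrib_right mult_ac)
    also have "\<dots> \<le> real k ^ (2 * g) * W ^ g * 4 ^ g"
      using sum_pade_coeff_le W by (intro mult_left_mono) auto
    finally show "real_of_int (P g) \<le> (4 * (real k)\<^sup>2 * W) ^ g"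
      unfolding P power_mult_distrib power_mult[of "real k" 2 g] by (simp only: ac_simps)
    have "\<bar>w powr \<alpha> * P g - Q g\<bar> = real k ^ (2 * g) * real V ^ g *
        \<bar>w powr \<alpha> * pade_num \<alpha> g w - pade_den \<alpha> g w\<bar>"
    proof -
      have "w powr \<alpha> * P g - Q g = real k ^ (2 * g) * real V ^ g *
          (w powr \<alpha> * pade_num \<alpha> g w - pade_den \<alpha> g w)"
        unfolding P Q Pw Qw by (simp add: algebra_simps)
      then show ?thesis by (simp add: abs_mult)
    qed
    also have "\<dots> \<le> real k ^ (2 * g) * real V ^ g * (2 * \<bar>1 - w\<bar> ^ (2 * g + 1))"
      using pade_remainder[OF \<alpha> w] by (intro mult_left_mono) auto
    also have "\<dots> = 2 * \<bar>1 - w\<bar> * ((real k)\<^sup>2 * real V * (1 - w)\<^sup>2) ^ g"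
    proof -
      have "\<bar>1 - w\<bar> ^ (2 * g + 1) = \<bar>1 - w\<bar> * ((1 - w)\<^sup>2) ^ g" by (simp add: power_mult)
      then show ?thesis by (simp add: power_mult_distrib power_mult)
    qed
    finally show "\<bar>(real U / real V) powr (1 / real k) * P g - Q g\<bar>
        \<le> 2 * \<bar>1 - real U / real V\<bar> * ((real k)\<^sup>2 * real V * (1 - real U / real V)\<^sup>2) ^ g"
      by (simp only: w_def \<alpha>_def)
    show "P g * Q (Suc g) \<noteq> P (Suc g) * Q g"
    proof
      assume "P g * Q (Suc g) = P (Suc g) * Q g"
      then have "real_of_int (P g) * real_of_int (Q (Suc g)) = real_of_int (P (Suc g)) * real_of_int (Q g)"
        by (metis of_int_mult)
      then have "(real k ^ (2 * g) * real V ^ g * (real k ^ (2 * Suc g) * real V ^ Suc g)) *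
          (pade_num \<alpha> g w * pade_den \<alpha> (Suc g) w) =
          (real k ^ (2 * g) * real V ^ g * (real k ^ (2 * Suc g) * real V ^ Suc g)) *
          (pade_num \<alpha> (Suc g) w * pade_den \<alpha> g w)"
        unfolding P Q Pw Qw by (simp only: mult_ac)
      moreover have "real k ^ (2 * g) * real V ^ g * (real k ^ (2 * Suc g) * real V ^ Suc g) \<noteq> 0"
        using k V by simp
      ultimately show False using pade_determinant_nonzero[OF \<alpha> w1, of g] by (metis mult_cancel_left)
    qed
  qed
qed

text \<open>The cofactor of s-t in a difference of powers is at least \<open>\<mu> ^ j\<close>. This
  converts a bound for k-th powers into one for their roots.\<close>

lemma abs_diff_times_power_le:
  fixes s t \<mu> :: real
  assumes "0 \<le> \<mu>" "\<mu> \<le> s" "\<mu> \<le> t"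
  shows "\<bar>s - t\<bar> * \<mu> ^ j \<le> \<bar>s ^ Suc j - t ^ Suc j\<bar>"
proof -
  have aux: "(s - t) * \<mu> ^ j \<le> s ^ Suc j - t ^ Suc j" if "t \<le> s" "\<mu> \<le> t" for s t
  proof -
    have "(s - t) * \<mu> ^ j \<le> (s - t) * t ^ j"
      using that assms by (intro mult_left_mono power_mono) auto
    also have "\<dots> \<le> s * s ^ j - t * t ^ j"
    proof -
      have "s * t ^ j \<le> s * s ^ j" using that assms by (intro mult_left_mono power_mono) auto
      then show ?thesis by (simp add: algebra_simps)
    qed
    finally show ?thesis by simp
  qed
  show ?thesis
  proof (cases "t \<le> s")
    case True
    with aux[of t s] assms show ?thesis by (simp add: abs_if)
  next
    case False
    with aux[of s t] assms show ?thesis by (simp add: abs_if)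
  qed
qed

text \<open>Since b >= 3^(k/2), fixed powers of b beat polynomials in k. At k = 3 the bound b^2 >=
  27 alone is too weak (27^6 < 128 * 54^4), and integrality, b >= 6, is needed.\<close>

lemma size_constants:
  fixes k b :: nat
  assumes k: "k \<ge> 3" and b: "3 ^ k \<le> b\<^sup>2"
  shows "6 \<le> b" "128 * (6 * k\<^sup>2) ^ 4 \<le> b ^ 12" "288 * k ^ 10 \<le> b ^ 10"
proof -
  show b6: "6 \<le> b"
  proof (rule ccontr)
    assume "\<not> 6 \<le> b"
    then have "b\<^sup>2 \<le> 5\<^sup>2" by (intro power_mono) auto
    moreover have "(3::nat) ^ 3 \<le> 3 ^ k" using k by (intro power_increasing) auto
    ultimately show False using b by simp
  qed
  have "128 * (6 * k\<^sup>2) ^ 4 \<le> b ^ 12 \<and> 288 * k ^ 10 \<le> b ^ 10"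
  proof (cases "k = 3")
    case True
    have "(6::nat) ^ 12 \<le> b ^ 12" "(6::nat) ^ 10 \<le> b ^ 10" by (rule power_mono[OF b6], simp)+
    then show ?thesis using True by simp
  next
    case False
    then have k4: "k \<ge> 4" using k by simp
    have "165888 * k ^ 8 \<le> 3 ^ (6 * k) \<and> 288 * k ^ 10 \<le> (3::nat) ^ (5 * k)"
      using k4
    proof (induction k rule: dec_induct)
      case base
      then show ?case by simp
    next
      case (step j)
      have "(2 * Suc j) ^ 8 \<le> (3 * j) ^ 8" "(2 * Suc j) ^ 10 \<le> (3 * j) ^ 10"
        by (rule power_mono; use step.hyps in simp)+
      then have "256 * Suc j ^ 8 \<le> 6561 * j ^ 8" "1024 * Suc j ^ 10 \<le> 59049 * j ^ 10"
        by (simp_all only: power_mult_distrib) simp_all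
      then show ?case using step.IH by (simp add: power_add)
    qed
    moreover have "(3::nat) ^ (6 * k) \<le> b ^ 12" "(3::nat) ^ (5 * k) \<le> b ^ 10"
    proof -
      have "((3::nat) ^ k) ^ 6 \<le> (b\<^sup>2) ^ 6" "((3::nat) ^ k) ^ 5 \<le> (b\<^sup>2) ^ 5"
        by (rule power_mono[OF b], simp)+
      then show "(3::nat) ^ (6 * k) \<le> b ^ 12" "(3::nat) ^ (5 * k) \<le> b ^ 10"
        by (simp_all add: power_mult[symmetric] mult.commute)
    qed
    moreover have "128 * (6 * k\<^sup>2) ^ 4 = 165888 * k ^ 8"
      by (simp add: power_mult_distrib flip: power_mult)
    ultimately show ?thesis by linarith
  qed
  then show "128 * (6 * k\<^sup>2) ^ 4 \<le> b ^ 12" "288 * k ^ 10 \<le> b ^ 10" by auto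
qed

text \<open>If it failed, cancellation would leave D^(2k-5) <= B^(22k+9) C^(4k+2). The exponent 17
  turns this into C^(30k-87) <= B^(22k+9), and 26 refutes it. At k = 3 the last comparison is 26 * 3
  = 78 > 75, so neither exponent could be lowered here.\<close>

lemma size_contradiction:
  fixes A B C D M :: real and k :: nat
  assumes k: "k \<ge> 3" and A: "1 \<le> A" "A \<le> B" and B: "6 \<le> B" "128 * (6 * (real k)\<^sup>2) ^ 4 \<le> B ^ 12"
    and C: "B ^ 26 \<le> C" and D: "C ^ 17 \<le> D" and M: "0 \<le> M" "M \<le> A\<^sup>2"
  shows "32 ^ k * M ^ (2 * k) * (2 * B * C)\<^sup>2 * (6 * (real k)\<^sup>2 * A * B * C) ^ (4 * k) * (2 * B * D) ^ 3
      < (A * D / 2) ^ (2 * k - 2)"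
proof (rule ccontr)
  assume "\<not> ?thesis"
  then have H: "(A * D / 2) ^ (2 * k - 2) \<le>
      32 ^ k * M ^ (2 * k) * (2 * B * C)\<^sup>2 * (6 * (real k)\<^sup>2 * A * B * C) ^ (4 * k) * (2 * B * D) ^ 3"
    by simp
  have B1: "1 < B" using B by simp
  have C1: "1 < C" using C one_less_power[OF B1, of 26] by simp
  have D1: "1 < D" using D one_less_power[OF C1, of 17] by simp
  define R where "R = A ^ (2 * k - 2) * D ^ 3 / 2 ^ (2 * k - 2)"
  have R0: "R > 0" using A D1 by (simp add: R_def)
  have lhs: "(A * D / 2) ^ (2 * k - 2) = R * D ^ (2 * k - 5)"
  proof -
    have "D ^ (2 * k - 2) = D ^ 3 * D ^ (2 * k - 5)" using k by (simp add: power_add[symmetric])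
    then show ?thesis by (simp add: R_def power_mult_distrib power_divide)
  qed
  have "32 ^ k * M ^ (2 * k) * (2 * B * C)\<^sup>2 * (6 * (real k)\<^sup>2 * A * B * C) ^ (4 * k) * (2 * B * D) ^ 3
      \<le> 32 ^ k * (A\<^sup>2) ^ (2 * k) * (2 * B * C)\<^sup>2 * (6 * (real k)\<^sup>2 * A * B * C) ^ (4 * k) * (2 * B * D) ^ 3"
    using M A B1 C1 D1 by (intro mult_right_mono mult_left_mono power_mono) auto
  also have "\<dots> = R * (2 ^ (7 * k + 3) * ((6 * (real k)\<^sup>2) ^ 4) ^ k * (A ^ (6 * k + 2) * B ^ (4 * k + 5)) * C ^ (4 * k + 2))"
  proof -
    have e1: "(A\<^sup>2) ^ (2 * k) * A ^ (4 * k) = A ^ (2 * k - 2) * A ^ (6 * k + 2)"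
    proof -
      have "(A\<^sup>2) ^ (2 * k) * A ^ (4 * k) = A ^ (8 * k)"
        by (simp only: power_mult[symmetric] power_add[symmetric]) simp
      moreover have "(2 * k - 2) + (6 * k + 2) = 8 * k" using k by simp
      ultimately show ?thesis by (simp only: power_add[symmetric])
    qed
    have two: "2 ^ (2 * k - 2) * 2 ^ 2 = (2::real) ^ (2 * k)"
    proof -
      have "(2 * k - 2) + 2 = 2 * k" using k by simp
      then show ?thesis by (metis power_add)
    qed
    have e2: "2 ^ (7 * k + 3) = 32 * 32 ^ k * (2::real) ^ (2 * k - 2)"
    proof -
      have "(2::real) ^ (7 * k + 3) = 2 ^ (5 * k) * 2 ^ (2 * k) * 8"
        by (simp add: power_add[symmetric]) (simp add: power_add)
      also have "\<dots> = 32 ^ k * (2 ^ (2 * k - 2) * 2 ^ 2) * 8" by (simp only: two power_mult) simp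
      finally show ?thesis by simp
    qed
    have "32 ^ k * (A\<^sup>2) ^ (2 * k) * (2 * B * C)\<^sup>2 * (6 * (real k)\<^sup>2 * A * B * C) ^ (4 * k) * (2 * B * D) ^ 3
        = 32 * 32 ^ k * ((A\<^sup>2) ^ (2 * k) * A ^ (4 * k)) * ((6 * (real k)\<^sup>2) ^ (4 * k)) * (B ^ 2 * B ^ (4 * k) * B ^ 3) * (C ^ 2 * C ^ (4 * k)) * D ^ 3"
      by (simp add: power_mult_distrib)
    also have "\<dots> = 32 * 32 ^ k * (A ^ (2 * k - 2) * A ^ (6 * k + 2)) * ((6 * (real k)\<^sup>2) ^ 4) ^ k * B ^ (4 * k + 5) * C ^ (4 * k + 2) * D ^ 3"
    proof -
      have "B ^ 2 * B ^ (4 * k) * B ^ 3 = B ^ (4 * k + 5)" "C ^ 2 * C ^ (4 * k) = C ^ (4 * k + 2)"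
        by (simp_all only: power_add[symmetric]) (simp_all add: add_ac)
      then show ?thesis by (simp only: e1 power_mult[of "6 * (real k)\<^sup>2" 4 k])
    qed
    also have "\<dots> = R * (2 ^ (7 * k + 3) * ((6 * (real k)\<^sup>2) ^ 4) ^ k * (A ^ (6 * k + 2) * B ^ (4 * k + 5)) * C ^ (4 * k + 2))"
      unfolding R_def e2 by simp
    finally show ?thesis .
  qed
  finally have "R * D ^ (2 * k - 5) \<le> R * (2 ^ (7 * k + 3) * ((6 * (real k)\<^sup>2) ^ 4) ^ k * (A ^ (6 * k + 2) * B ^ (4 * k + 5)) * C ^ (4 * k + 2))"
    using H lhs by linarith
  then have "D ^ (2 * k - 5) \<le> 2 ^ (7 * k + 3) * ((6 * (real k)\<^sup>2) ^ 4) ^ k * (A ^ (6 * k + 2) * B ^ (4 * k + 5)) * C ^ (4 * k + 2)"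
    using R0 by simp
  \<comment> \<open>All numerical constants are traded for powers of B: 8 <= B^2, and the k-th power
    of 128 (6k^2)^4 <= B^12.\<close>
  also have "\<dots> \<le> B ^ (12 * k + 2) * (B ^ (6 * k + 2) * B ^ (4 * k + 5)) * C ^ (4 * k + 2)"
  proof (intro mult_mono power_mono)
    have "(8::real) \<le> B\<^sup>2" using power_mono[OF B(1), of 2] by simp
    then have "8 * (128 * (6 * (real k)\<^sup>2) ^ 4) ^ k \<le> B\<^sup>2 * (B ^ 12) ^ k"
      using B by (intro mult_mono power_mono) auto
    then show "2 ^ (7 * k + 3) * ((6 * (real k)\<^sup>2) ^ 4) ^ k \<le> B ^ (12 * k + 2)"
    proof -
      have "2 ^ (7 * k + 3) = 8 * (128::real) ^ k" by (simp add: power_add power_mult)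
      moreover have "B ^ (12 * k + 2) = B\<^sup>2 * (B ^ 12) ^ k"
        by (subst add.commute) (simp only: power_add power_mult)
      ultimately show ?thesis
        using \<open>8 * (128 * (6 * (real k)\<^sup>2) ^ 4) ^ k \<le> B\<^sup>2 * (B ^ 12) ^ k\<close>
        by (simp only: power_mult_distrib[of 128] mult.assoc)
    qed
  qed (use A B C1 in auto)
  also have "\<dots> = B ^ (22 * k + 9) * C ^ (4 * k + 2)"
    by (simp only: power_add[symmetric]) (simp add: add_ac)
  finally have "D ^ (2 * k - 5) \<le> B ^ (22 * k + 9) * C ^ (4 * k + 2)" .
  moreover have "(C ^ 17) ^ (2 * k - 5) \<le> D ^ (2 * k - 5)" using D C1 by (intro power_mono) auto
  moreover have "(C ^ 17) ^ (2 * k - 5) = C ^ (30 * k - 87) * C ^ (4 * k + 2)"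
  proof -
    have "17 * (2 * k - 5) = (30 * k - 87) + (4 * k + 2)" using k by simp
    then show ?thesis by (simp only: power_add[symmetric] power_mult[symmetric])
  qed
  ultimately have "C ^ (30 * k - 87) * C ^ (4 * k + 2) \<le> B ^ (22 * k + 9) * C ^ (4 * k + 2)" by linarith
  then have "C ^ (30 * k - 87) \<le> B ^ (22 * k + 9)" using C1 by simp
  moreover have "(B ^ 26) ^ (30 * k - 87) \<le> C ^ (30 * k - 87)" using C B1 by (intro power_mono) auto
  ultimately have "B ^ (26 * (30 * k - 87)) \<le> B ^ (22 * k + 9)" by (simp only: power_mult)
  then have "26 * (30 * k - 87) \<le> 22 * k + 9" using B1 by simp
  then show False using k by linarith
qed

lemma power_root_powr:
  fixes y :: real
  assumes "0 < y" "0 < k"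
  shows "(y ^ k) powr (1 / real k) = y"
  using assms by (simp add: powr_powr flip: powr_realpow)

text \<open>The solution \<open>(x, y)\<close> makes \<open>w = a y\<^sup>k / (b x\<^sup>k)\<close> close to \<open>1\<close>, so the Pade approximants at \<open>w\<close>
  give good rational approximations to \<open>(a / b)\<^sup>1\<^sup>/\<^sup>k\<close>. The solution \<open>(x', y')\<close> gives another one,
  and the two are too close to each other to be different.\<close>

lemma no_two_distant_solutions:
  fixes k a b c d x y x' y' :: nat and n :: int
  assumes k: "k \<ge> 3" and a: "0 < a" "a < b" and n: "n \<noteq> 0" "\<bar>n\<bar> \<le> (int a)\<^sup>2"
    and b: "3 ^ k \<le> b\<^sup>2" and c: "b ^ 26 \<le> c" and d: "c ^ 17 \<le> d"
    and x: "int x ^ k = int a * int c + n" and y: "int y ^ k = int b * int c + n"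
    and x': "int x' ^ k = int a * int d + n" and y': "int y' ^ k = int b * int d + n"
  shows False
proof -
  define A B C D M N where "A = real a" and "B = real b" and "C = real c" and "D = real d"
    and "M = real_of_int \<bar>n\<bar>" and "N = real_of_int n"
  define K where "K = (real k)\<^sup>2"
  note const = size_constants[OF k b, THEN of_nat_mono[where 'a = real]]
  have B6: "6 \<le> B" using const(1) by (simp add: B_def)
  have B12: "128 * (6 * (real k)\<^sup>2) ^ 4 \<le> B ^ 12"
    using const(2) by (simp only: B_def of_nat_mult of_nat_power of_nat_numeral)
  have B10: "288 * real k ^ 10 \<le> B ^ 10"
    using const(3) by (simp only: B_def of_nat_mult of_nat_power of_nat_numeral)
  have A1: "1 \<le> A" "A + 1 \<le> B" using a by (auto simp: A_def B_def)
  have "real_of_int \<bar>n\<bar> \<le> real_of_int ((int a)\<^sup>2)" using n(2) by (rule of_int_le_iff[THEN iffD2])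
  then have M: "1 \<le> M" "M \<le> A\<^sup>2" using n(1) by (auto simp: M_def A_def)
  have NM: "\<bar>N\<bar> = M" by (simp add: M_def N_def)
  have C26: "B ^ 26 \<le> C" using of_nat_mono[OF c, where 'a = real] by (simp only: B_def C_def of_nat_power)
  have D17: "C ^ 17 \<le> D" using of_nat_mono[OF d, where 'a = real] by (simp only: D_def C_def of_nat_power)
  have xk: "real x ^ k = A * C + N"
    using arg_cong[OF x, of real_of_int] by (simp add: A_def C_def N_def)
  have yk: "real y ^ k = B * C + N"
    using arg_cong[OF y, of real_of_int] by (simp add: B_def C_def N_def)
  have xk': "real x' ^ k = A * D + N"
    using arg_cong[OF x', of real_of_int] by (simp add: A_def D_def N_def)
  have yk': "real y' ^ k = B * D + N"
    using arg_cong[OF y', of real_of_int] by (simp add: B_def D_def N_def)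
  have B1: "1 \<le> B" "0 < B" "0 < A" using B6 A1 by auto
  have AB: "A \<le> B" using A1 by simp
  have CB: "16 * B ^ 8 \<le> C"
  proof -
    have "(16::real) \<le> B ^ 2" using power_mono[OF B6, of 2] by simp
    then have "16 * B ^ 8 \<le> B ^ 2 * B ^ 8" using B1 by (intro mult_right_mono) auto
    also have "\<dots> = B ^ 10" by (simp add: power_add[symmetric])
    also have "\<dots> \<le> B ^ 26" using B1 by (intro power_increasing) auto
    finally show ?thesis using C26 by simp
  qed
  have C0: "0 < C" "1 \<le> C" using C26 one_le_power[OF B1(1), of 26] by auto
  have CD: "C \<le> D" using D17 power_increasing[of 1 17 C] C0 by simp
  have MA: "M \<le> A * C / 2" "M \<le> A * D / 2" "8 * M\<^sup>2 \<le> A * C / 2"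
  proof -
    have "8 * M\<^sup>2 \<le> 8 * (A\<^sup>2)\<^sup>2" using M by (intro mult_left_mono power_mono) auto
    also have "\<dots> = A * (8 * A ^ 3)" by (simp add: eval_nat_numeral)
    also have "\<dots> \<le> A * (8 * B ^ 8)"
      using AB B1 by (intro mult_left_mono order.trans[OF power_mono power_increasing]) auto
    also have "\<dots> \<le> A * (C / 2)" using CB B1 by (intro mult_left_mono) auto
    finally show "8 * M\<^sup>2 \<le> A * C / 2" by simp
    moreover have "M \<le> M\<^sup>2" using M by (simp add: power2_eq_square)
    ultimately show "M \<le> A * C / 2" using M by linarith
    also have "\<dots> \<le> A * D / 2" using CD B1 by simp
    finally show "M \<le> A * D / 2" .
  qed
  have AC_BC: "A * C \<le> B * C" "A * D \<le> B * D" using AB C0 CD by auto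
  have ACpos: "0 < A * C" "0 < A * D" using B1 C0 CD by auto
  have xl: "A * C / 2 \<le> real x ^ k" using MA NM unfolding xk by linarith
  have yu: "real y ^ k \<le> 2 * B * C" using MA NM AC_BC ACpos unfolding yk by linarith
  have yl: "0 < real y ^ k" using MA NM AC_BC ACpos unfolding yk by linarith
  have xl': "A * D / 2 \<le> real x' ^ k" using MA NM unfolding xk' by linarith
  have yu': "real y' ^ k \<le> 2 * B * D" using MA NM AC_BC ACpos unfolding yk' by linarith
  have yl': "A * D / 2 \<le> real y' ^ k" using MA NM AC_BC ACpos unfolding yk' by linarith
  have pos: "x > 0" "y > 0" "x' > 0" "y' > 0"
    using xl yl xl' yl' ACpos k by (auto intro!: Nat.gr0I simp: zero_power)

  \<comment> \<open>V - U = n(b-a) is tiny compared with V, so U/V is near 1; its k-th root is y/x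
    times (a/b)^(1/k).\<close>
  define U V where "U = a * y ^ k" and "V = b * x ^ k"
  have RU: "real U = A * (B * C + N)" and RV: "real V = B * (A * C + N)"
    unfolding xk[symmetric] yk[symmetric] by (simp_all add: U_def V_def A_def B_def)
  define w where "w = real U / real V"
  have VU: "real V - real U = N * (B - A)" by (simp add: RU RV algebra_simps)
  have UVpos: "U > 0" "V > 0" using a pos by (auto simp: U_def V_def)
  have MB: "\<bar>N * (B - A)\<bar> \<le> M * B"
    using NM A1 M by (auto simp: abs_mult intro!: mult_left_mono)
  have ABC: "B * M \<le> A * B * C / 2" "A * M \<le> A * B * C / 2"
  proof -
    show "B * M \<le> A * B * C / 2" using mult_left_mono[OF MA(1), of B] B1 by (simp add: mult_ac)
    then show "A * M \<le> A * B * C / 2" using mult_right_mono[OF AB, of M] M by linarith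
  qed
  have BN: "\<bar>B * N\<bar> = B * M" "\<bar>A * N\<bar> = A * M" using NM B1 by (simp_all add: abs_mult)
  have "real V \<le> 2 * real U"
    using VU MB ABC BN unfolding RU RV by (simp add: algebra_simps)
  then have V2U: "V \<le> 2 * U" by linarith
  have UV: "U \<noteq> V"
  proof
    assume "U = V"
    then have "N * (B - A) = 0" using VU by simp
    then show False using n(1) A1 by (simp add: N_def)
  qed
  define W where "W = 3 / 2 * (A * B * C)"
  have UW: "real U \<le> W" "real V \<le> W"
  proof -
    have "real U = A * B * C + A * N" "real V = A * B * C + B * N"
      by (simp_all add: RU RV algebra_simps)
    then show "real U \<le> W" "real V \<le> W" using ABC BN unfolding W_def by linarith+
  qed
  obtain P Q :: "nat \<Rightarrow> int" where P0: "\<And>g. 0 \<le> P g"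
    and PW: "\<And>g. real_of_int (P g) \<le> (4 * (real k)\<^sup>2 * W) ^ g"
    and PQ: "\<And>g. \<bar>w powr (1 / real k) * P g - Q g\<bar>
        \<le> 2 * \<bar>1 - w\<bar> * ((real k)\<^sup>2 * real V * (1 - w)\<^sup>2) ^ g"
    and det: "\<And>g. P g * Q (Suc g) \<noteq> P (Suc g) * Q g"
    unfolding w_def
    using pade_integer_forms[of k U V W] k UVpos(1) UV UVpos(2) V2U UW by auto
  \<comment> \<open>\<open>F\<close> bounds the growth per degree of the integers \<open>P\<close>,
    and \<open>\<eta>\<close> the decay per degree of the linear forms.\<close>
  define F where "F = 6 * K * A * B * C"
  define \<eta> where "\<eta> = 2 * K * M\<^sup>2 * B / (A * C)"
  have PF: "real_of_int (P g) \<le> F ^ g" for g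
    using PW[of g] by (simp add: F_def W_def K_def mult_ac)
  have K1: "1 \<le> K" using k by (simp add: K_def)
  have F1: "1 \<le> F"
  proof -
    have "1 * 1 * 1 * 1 * 1 \<le> F" unfolding F_def
      using K1 A1 B1 C0 by (intro mult_mono) auto
    then show ?thesis by simp
  qed
  have eta0: "0 < \<eta>" using K1 M B1 C0 by (simp add: \<eta>_def)
  \<comment> \<open>Source of the 26: B^10 absorbs 288 k^10, M^6 <= A B^11 because M <= A^2, and B^5
    is already present; C must dominate the product.\<close>
  have Feta: "F\<^sup>2 * \<eta> ^ 3 \<le> 1"
  proof -
    have "F\<^sup>2 * \<eta> ^ 3 = 288 * K ^ 5 * B ^ 5 * M ^ 6 / (A * C)"
      using B1 C0 unfolding F_def \<eta>_def by (simp add: field_simps eval_nat_numeral)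
    also have "K ^ 5 = real k ^ 10" by (simp add: K_def flip: power_mult)
    also have "288 * real k ^ 10 * B ^ 5 * M ^ 6 / (A * C) \<le> B ^ 10 * B ^ 5 * (A * B ^ 11) / (A * C)"
    proof (intro divide_right_mono mult_mono)
      have "M ^ 6 \<le> (A\<^sup>2) ^ 6" using M by (intro power_mono) auto
      also have "\<dots> = A * A ^ 11" by (simp flip: power_mult power_Suc)
      also have "\<dots> \<le> A * B ^ 11" using AB B1 by (intro mult_left_mono power_mono) auto
      finally show "M ^ 6 \<le> A * B ^ 11" .
    qed (use B10 B1 C0 M in auto)
    also have "\<dots> = B ^ 26 / C"
    proof -
      have "B ^ 10 * B ^ 5 * B ^ 11 = B ^ 26" by (simp add: power_add[symmetric])
      moreover have "B ^ 10 * B ^ 5 * (A * B ^ 11) / (A * C) = B ^ 10 * B ^ 5 * B ^ 11 / C"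
        using B1 C0 by (simp add: field_simps)
      ultimately show ?thesis by simp
    qed
    also have "\<dots> \<le> 1" using C26 C0 by simp
    finally show ?thesis .
  qed
  have eta1: "\<eta> < 1"
  proof (rule ccontr)
    assume "\<not> \<eta> < 1"
    then have "1 \<le> \<eta> ^ 3" by (simp add: one_le_power)
    moreover have "F < F\<^sup>2 \<or> F = 1" using F1 by (auto simp: power2_eq_square)
    moreover have "6 * 1 \<le> F"
      using mult_mono[of 1 "K * A * B * C" 6 6] K1 A1 B1 C0
        mult_mono[of 1 K 1 A] mult_mono[of 1 "K * A" 1 B] mult_mono[of 1 "K * A * B" 1 C]
      by (simp add: F_def mult_ac)
    ultimately have "1 < F\<^sup>2 * \<eta> ^ 3"
      by (smt (verit) F1 mult_le_cancel_left1 mult_right_mono)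
    then show False using Feta by simp
  qed
  have w1: "\<bar>1 - w\<bar> \<le> M / real x ^ k"
  proof -
    have "\<bar>1 - w\<bar> = \<bar>N * (B - A)\<bar> / real V"
      using UVpos unfolding VU[symmetric] w_def by (simp add: field_simps abs_divide)
    also have "\<dots> \<le> M * B / real V" using MB by (intro divide_right_mono) auto
    also have "\<dots> = M / real x ^ k" using B1 by (simp add: V_def B_def)
    finally show ?thesis .
  qed
  have xpos: "0 < real x ^ k" using pos by simp
  have etaV: "(real k)\<^sup>2 * real V * (1 - w)\<^sup>2 \<le> \<eta>"
  proof -
    have "(1 - w)\<^sup>2 \<le> (M / real x ^ k)\<^sup>2" using w1 by (metis abs_ge_zero power2_abs power_mono)
    then have "K * real V * (1 - w)\<^sup>2 \<le> K * real V * (M / real x ^ k)\<^sup>2"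
      using K1 by (intro mult_left_mono) auto
    also have "\<dots> = K * M\<^sup>2 * B / real x ^ k"
      using xpos by (simp add: V_def B_def power2_eq_square)
    also have "\<dots> \<le> K * M\<^sup>2 * B / (A * C / 2)"
      using xl K1 B1 ACpos xpos by (intro divide_left_mono) auto
    finally show ?thesis by (simp add: \<eta>_def K_def mult_ac)
  qed
  \<comment> \<open>Clearing the denominator x of w^(1/k) costs the factor 2x|1-w|. It is at most 1
    because x^(2k-2) >= x^k >= 8 M^2, hence x^(k-1) >= 2M.\<close>
  have x2: "2 * real x * \<bar>1 - w\<bar> \<le> 1"
  proof -
    have "2 * M \<le> real x ^ (k - 1)"
    proof (rule ccontr)
      assume "\<not> 2 * M \<le> real x ^ (k - 1)"
      then have "(real x ^ (k - 1))\<^sup>2 < (2 * M)\<^sup>2" by (intro power_strict_mono) auto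
      moreover have "real x ^ k \<le> real x ^ ((k - 1) * 2)"
        using pos k by (intro power_increasing) auto
      moreover have "0 < M\<^sup>2" using M by simp
      ultimately show False using xl MA(3) by (simp add: power_mult power_mult_distrib)
    qed
    moreover have "real x ^ k = real x * real x ^ (k - 1)"
      using k by (metis power_eq_if not_numeral_le_zero)
    ultimately have "2 * real x * M \<le> real x ^ k"
      using pos by (simp add: mult_left_mono mult_ac)
    then have "2 * real x * (M / real x ^ k) \<le> 1" using xpos by (simp add: field_simps)
    moreover have "2 * real x * \<bar>1 - w\<bar> \<le> 2 * real x * (M / real x ^ k)"
      using w1 by (intro mult_left_mono) auto
    ultimately show ?thesis by linarith
  qed

  define \<theta> where "\<theta> = (A / B) powr (1 / real k)"
  have th0: "0 < \<theta>" using B1 by (simp add: \<theta>_def)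
  have thk: "\<theta> ^ k = A / B"
    using B1 k by (simp add: \<theta>_def powr_powr flip: powr_realpow)
  have wth: "w powr (1 / real k) = \<theta> * real y / real x"
  proof -
    have "w = A / B * (real y ^ k) / (real x ^ k)" by (simp add: w_def U_def V_def A_def B_def)
    then have "w powr (1 / real k) = \<theta> * (real y ^ k) powr (1 / real k) / (real x ^ k) powr (1 / real k)"
      using B1 pos by (simp add: powr_mult powr_divide \<theta>_def)
    then show ?thesis using pos k by (simp add: power_root_powr)
  qed
  have form: "\<bar>\<theta> * real y * P g - real x * Q g\<bar> \<le> \<eta> ^ g" for g
  proof -
    have "\<theta> * real y * P g - real x * Q g = real x * (w powr (1 / real k) * P g - Q g)"
      using pos by (simp add: wth field_simps)
    then have "\<bar>\<theta> * real y * P g - real x * Q g\<bar> = real x * \<bar>w powr (1 / real k) * P g - Q g\<bar>"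
      by (simp add: abs_mult)
    also have "\<dots> \<le> real x * (2 * \<bar>1 - w\<bar> * ((real k)\<^sup>2 * real V * (1 - w)\<^sup>2) ^ g)"
      by (intro mult_left_mono PQ) auto
    also have "\<dots> = (2 * real x * \<bar>1 - w\<bar>) * ((real k)\<^sup>2 * real V * (1 - w)\<^sup>2) ^ g" by simp
    also have "\<dots> \<le> 1 * \<eta> ^ g"
      using x2 etaV by (intro mult_mono power_mono) auto
    finally show ?thesis by simp
  qed
  define \<mu> where "\<mu> = min (real x') (\<theta> * real y')"
  have mu0: "0 < \<mu>" using th0 pos by (simp add: \<mu>_def)
  define E where "E = \<bar>real x' - \<theta> * real y'\<bar>"
  have thy: "(\<theta> * real y') ^ k = A * D + A * N / B"
    using B1 by (simp add: power_mult_distrib thk yk' field_simps)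
  have ANB: "\<bar>A * N / B\<bar> \<le> M"
    using AB M NM B1 by (simp add: abs_mult field_simps mult_left_mono)
  have muk: "A * D / 2 \<le> \<mu> ^ k"
  proof -
    have "A * D / 2 \<le> (\<theta> * real y') ^ k" using thy ANB MA(2) by linarith
    then show ?thesis using xl' by (simp add: \<mu>_def min_def)
  qed
  \<comment> \<open>The difference of the k-th powers of x' and \<theta>y' is n(b-a)/b, at most |n|.
    Thus the second solution approximates \<theta> with an error controlled by
    \<open>\<mu>\<close>.\<close>
  have EM: "E * \<mu> ^ (k - 1) \<le> M"
  proof -
    have "Suc (k - 1) = k" using k by simp
    then have "E * \<mu> ^ (k - 1) \<le> \<bar>real x' ^ k - (\<theta> * real y') ^ k\<bar>"
      using abs_diff_times_power_le[of \<mu> "real x'" "\<theta> * real y'" "k - 1"] mu0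
      by (simp only: E_def) (simp add: \<mu>_def)
    also have "real x' ^ k - (\<theta> * real y') ^ k = N * (B - A) / B"
      unfolding xk' thy using B1 by (simp add: field_simps)
    also have "\<bar>\<dots>\<bar> \<le> M" using MB B1 by (simp add: abs_divide field_simps)
    finally show ?thesis .
  qed

  have "\<exists>g. \<eta> ^ g < 1 / (2 * real y')"
    using eta0 eta1 pos by (intro real_arch_pow_inv) auto
  then have ex: "\<exists>g. 2 * real y' * \<eta> ^ g < 1" using pos by (simp add: field_simps)
  \<comment> \<open>The least degree at which the linear form, multiplied by y', drops below 1/2.
    Minimality will bound F^g by a power of y'.\<close>
  define g where "g = (LEAST g. 2 * real y' * \<eta> ^ g < 1)"
  have g1: "2 * real y' * \<eta> ^ g < 1" unfolding g_def by (rule LeastI_ex[OF ex])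
  have gmin: "1 \<le> 2 * real y' * \<eta> ^ h" if "h < g" for h
    using not_less_Least[of h "\<lambda>g. 2 * real y' * \<eta> ^ g < 1"] that unfolding g_def by simp
  \<comment> \<open>\<open>\<Delta> g\<close> vanishes exactly when the approximant of degree g
    yields the same fraction as the second solution; independence of consecutive approximants
    excludes this for g or g+1.\<close>
  define \<Delta> where "\<Delta> g = int y * P g * int x' - int x * Q g * int y'" for g
  have "\<Delta> g \<noteq> 0 \<or> \<Delta> (Suc g) \<noteq> 0"
  proof (rule ccontr)
    assume "\<not> ?thesis"
    then have e1: "int y * P g * int x' = int x * Q g * int y'"
      and e2: "int y * P (Suc g) * int x' = int x * Q (Suc g) * int y'" by (simp_all add: \<Delta>_def)
    have "(int y * P g * int x') * (int x * Q (Suc g) * int y') =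
        (int x * Q g * int y') * (int y * P (Suc g) * int x')"
      by (simp only: e1 e2)
    then have "(int y * int x' * int x * int y') * (P g * Q (Suc g)) =
        (int y * int x' * int x * int y') * (P (Suc g) * Q g)"
      by (simp only: mult_ac)
    then show False using det[of g] pos by simp
  qed
  then obtain j where j: "j = g \<or> j = Suc g" "\<Delta> j \<noteq> 0" by blast
  have "2 * real y' * \<eta> ^ j \<le> 2 * real y' * \<eta> ^ g"
    using j eta0 eta1 by (intro mult_left_mono power_decreasing) auto
  then have yj: "real y' * \<eta> ^ j < 1 / 2" using g1 by linarith
  have Fj: "F ^ j \<le> F ^ (g + 1)" using j F1 by (intro power_increasing) auto
  \<comment> \<open>A nonzero integer is split into an error of the second solution and an error of
    the approximant. The latter is below 1/2, so the former is at least 1/2.\<close>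
  have "1 \<le> \<bar>real_of_int (\<Delta> j)\<bar>" using j(2) by linarith
  also have "real_of_int (\<Delta> j) =
      real y * P j * (real x' - \<theta> * real y') + real y' * (\<theta> * real y * P j - real x * Q j)"
    by (simp add: \<Delta>_def algebra_simps)
  also have "\<bar>\<dots>\<bar> \<le> real y * P j * E + real y' * \<bar>\<theta> * real y * P j - real x * Q j\<bar>"
    using P0[of j] by (intro order.trans[OF abs_triangle_ineq]) (simp add: E_def abs_mult)
  also have "\<dots> \<le> real y * F ^ (g + 1) * E + real y' * \<eta> ^ j"
    using order.trans[OF PF[of j] Fj] form[of j] P0[of j]
    by (intro add_mono mult_mono mult_left_mono) (auto simp: E_def)
  finally have E1: "1 \<le> 2 * (real y * F ^ (g + 1) * E)" using yj by linarith
  have mu1: "\<mu> ^ (k - 1) \<le> 2 * real y * F ^ (g + 1) * M"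
  proof -
    have "\<mu> ^ (k - 1) * 1 \<le> \<mu> ^ (k - 1) * (2 * (real y * F ^ (g + 1) * E))"
      using E1 mu0 by (intro mult_left_mono) auto
    also have "\<dots> = 2 * real y * F ^ (g + 1) * (E * \<mu> ^ (k - 1))" by simp
    also have "\<dots> \<le> 2 * real y * F ^ (g + 1) * M"
      using EM F1 by (intro mult_left_mono) auto
    finally show ?thesis by simp
  qed
  \<comment> \<open>For g > 0, minimality gives 1 <= 2 y' \<eta>^(g-1). Its cube, with F^2 \<eta>^3
    <= 1, gives F^(2(g-1)) <= 8 y'^3; F^4 covers the two remaining degrees.\<close>
  have Fg: "(F ^ (g + 1))\<^sup>2 \<le> F ^ 4 * (8 * real y' ^ 3)"
  proof (cases g)
    case 0
    have "1 \<le> real y' ^ 3" using pos by (intro one_le_power) auto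
    then have "F ^ 2 * 1 \<le> F ^ 4 * (8 * real y' ^ 3)"
      using F1 by (intro mult_mono power_increasing) auto
    then show ?thesis using 0 by simp
  next
    case (Suc h)
    then have "1 \<le> 2 * real y' * \<eta> ^ h" using gmin by simp
    then have "1 \<le> (2 * real y' * \<eta> ^ h) ^ 3" by (rule one_le_power)
    then have h3: "1 \<le> (8 * real y' ^ 3) * (\<eta> ^ 3) ^ h"
      by (simp add: power_mult_distrib flip: power_mult) (simp add: mult.commute)
    have "(F\<^sup>2 * \<eta> ^ 3) ^ h \<le> 1" using Feta F1 eta0 by (intro power_le_one) auto
    then have "(F\<^sup>2) ^ h * (\<eta> ^ 3) ^ h \<le> 1" by (simp add: power_mult_distrib)
    then have "(F\<^sup>2) ^ h * (\<eta> ^ 3) ^ h \<le> (8 * real y' ^ 3) * (\<eta> ^ 3) ^ h" using h3 by linarith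
    then have "(F\<^sup>2) ^ h \<le> 8 * real y' ^ 3" using eta0 by simp
    then have "F ^ 4 * (F\<^sup>2) ^ h \<le> F ^ 4 * (8 * real y' ^ 3)" using F1 by (intro mult_left_mono) auto
    moreover have "(F ^ (g + 1))\<^sup>2 = F ^ 4 * (F\<^sup>2) ^ h"
    proof -
      have "(g + 1) * 2 = 4 + 2 * h" using Suc by simp
      then show ?thesis by (simp only: power_mult[symmetric] power_add[symmetric])
    qed
    ultimately show ?thesis by simp
  qed
  have "(\<mu> ^ (k - 1))\<^sup>2 \<le> (2 * real y * F ^ (g + 1) * M)\<^sup>2"
    using mu1 mu0 by (intro power_mono) auto
  also have "\<dots> = 4 * (real y)\<^sup>2 * M\<^sup>2 * (F ^ (g + 1))\<^sup>2" by (simp only: power_mult_distrib) simp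
  also have "\<dots> \<le> 4 * (real y)\<^sup>2 * M\<^sup>2 * (F ^ 4 * (8 * real y' ^ 3))"
    by (intro mult_left_mono Fg) auto
  also have "\<dots> = 32 * M\<^sup>2 * (real y)\<^sup>2 * F ^ 4 * real y' ^ 3" by simp
  \<comment> \<open>Taking k-th powers replaces y, y' and \<open>\<mu>\<close> by y^k, y'^k and
    \<open>\<mu> ^ k\<close>, which are comparable to products of A, B, C, D.\<close>
  finally have "((\<mu> ^ (k - 1))\<^sup>2) ^ k \<le> (32 * M\<^sup>2 * (real y)\<^sup>2 * F ^ 4 * real y' ^ 3) ^ k"
    using mu0 by (intro power_mono) auto
  also have "\<dots> = 32 ^ k * M ^ (2 * k) * (real y ^ k)\<^sup>2 * F ^ (4 * k) * (real y' ^ k) ^ 3"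
    by (simp only: power_mult_distrib power_mult[symmetric] mult.commute[of k])
  also have "\<dots> \<le> 32 ^ k * M ^ (2 * k) * (2 * B * C)\<^sup>2 * F ^ (4 * k) * (2 * B * D) ^ 3"
    using yu yu' F1 M B1 C0 CD by (intro mult_mono power_mono) auto
  also have "\<dots> < (A * D / 2) ^ (2 * k - 2)"
    unfolding F_def K_def
    by (rule size_contradiction[OF k A1(1) AB B6 B12 C26 D17]) (use M in auto)
  also have "\<dots> \<le> (\<mu> ^ k) ^ (2 * k - 2)" using muk ACpos by (intro power_mono) auto
  also have "\<dots> = ((\<mu> ^ (k - 1))\<^sup>2) ^ k"
  proof -
    have "k * (2 * k - 2) = (k - 1) * 2 * k" using k by (simp add: algebra_simps)
    then show ?thesis by (simp only: power_mult[symmetric])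
  qed
  finally show False by simp
qed

section \<open>The gap principle\<close>

lemma power_Suc_diff_ge:
  fixes y :: nat
  shows "y ^ Suc j + Suc j * y ^ j \<le> (y + 1) ^ Suc j"
proof (induction j)
  case (Suc j)
  have "y ^ Suc (Suc j) + Suc (Suc j) * y ^ Suc j \<le> (y + 1) * (y ^ Suc j + Suc j * y ^ j)"
    by (simp add: algebra_simps)
  also have "\<dots> \<le> (y + 1) * (y + 1) ^ Suc j" by (intro mult_left_mono Suc.IH) simp
  finally show ?case by simp
qed simp

lemma four_power_le_self_power:
  assumes "(k::nat) \<ge> 3"
  shows "4 ^ (k - 1) \<le> k ^ k"
proof (cases "k = 3")
  case False
  then have "k \<ge> 4" using assms by simp
  then have "(4::nat) ^ (k - 1) \<le> k ^ (k - 1)" by (intro power_mono) auto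
  also have "\<dots> \<le> k ^ k" using assms by (intro power_increasing) auto
  finally show ?thesis .
qed simp

text \<open>Distinct k-th powers whose smaller root is Z differ by at least k Z^(k-1), while Z^k is
  at least acbd/4. Eliminating Z and cancelling (bd)^(k-1) gives the claim. The 4 occurs for n < 0,
  where each of two factors may be halved, and 4^(k-1) <= k^k absorbs it.\<close>

lemma gap_principle:
  fixes k a b c d m x1 x2 x3 x4 :: nat and n :: int
  assumes k: "k \<ge> 3" and ab: "0 < a" "a < b" and bc: "b < c" and cd: "c < d"
    and n: "n \<noteq> 0" and m: "int m = \<bar>n\<bar>" and neg: "n < 0 \<Longrightarrow> 2 * m \<le> a * c"
    and x1: "int x1 ^ k = int a * int c + n" and x2: "int x2 ^ k = int b * int d + n"
    and x3: "int x3 ^ k = int a * int d + n" and x4: "int x4 ^ k = int b * int c + n"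
  shows "(a * c) ^ (k - 1) \<le> m ^ k * (b * d)"
proof -
  define X Y where "X = x1 * x2" and "Y = x3 * x4"
  have Xk: "int X ^ k = (int a * int c + n) * (int b * int d + n)"
    by (simp add: X_def power_mult_distrib x1 x2)
  have Yk: "int Y ^ k = (int a * int d + n) * (int b * int c + n)"
    by (simp add: Y_def power_mult_distrib x3 x4)
  have diff: "int X ^ k - int Y ^ k = n * ((int b - int a) * (int d - int c))"
    by (simp add: Xk Yk algebra_simps)
  have p: "0 < (int b - int a) * (int d - int c)" using ab cd by simp
  have le: "(int b - int a) * (int d - int c) \<le> int b * int d" using ab cd by (intro mult_mono) auto
  have kS: "Suc (k - 1) = k" using k by simp
  \<comment> \<open>\<open>Z\<close> is the smaller root: \<open>Y\<close> for n > 0 and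
    \<open>X\<close> for n < 0.\<close>
  have "\<exists>Z. int k * int Z ^ (k - 1) \<le> int m * (int b * int d) \<and> a * c * (b * d) \<le> 4 * Z ^ k"
  proof (cases "n > 0")
    case True
    then have "0 < int X ^ k - int Y ^ k" unfolding diff using p by simp
    then have "Y ^ k < X ^ k" by (simp flip: of_nat_power)
    then have "Y + 1 \<le> X" by (metis Suc_eq_plus1 Suc_leI power_less_imp_less_base zero_le)
    then have "(Y + 1) ^ k \<le> X ^ k" by (intro power_mono) auto
    then have "Y ^ k + k * Y ^ (k - 1) \<le> X ^ k"
      using power_Suc_diff_ge[of Y "k - 1", unfolded kS] by (rule order.trans[rotated])
    then have "int (Y ^ k + k * Y ^ (k - 1)) \<le> int (X ^ k)" by (rule of_nat_mono)
    then have "int k * int Y ^ (k - 1) \<le> n * ((int b - int a) * (int d - int c))"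
      using diff by simp
    also have "\<dots> \<le> n * (int b * int d)" using le True by (intro mult_left_mono) auto
    also have "n = int m" using m True by simp
    finally have 1: "int k * int Y ^ (k - 1) \<le> int m * (int b * int d)" .
    have "int a * int d * (int b * int c) \<le> int Y ^ k"
      unfolding Yk using True by (intro mult_mono) auto
    then have "int (a * c * (b * d)) \<le> int (Y ^ k)" by (simp add: mult_ac)
    then have "a * c * (b * d) \<le> Y ^ k" by (simp only: of_nat_le_iff)
    then show ?thesis using 1 by (intro exI[of _ Y]) auto
  next
    case False
    then have n0: "n < 0" using n by simp
    then have nm: "n = - int m" using m by simp
    have "int X ^ k - int Y ^ k < 0" unfolding diff using p n0 by (simp add: mult_neg_pos)
    then have "X ^ k < Y ^ k" by (simp flip: of_nat_power)
    then have "X + 1 \<le> Y" by (metis Suc_eq_plus1 Suc_leI power_less_imp_less_base zero_le)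
    then have "(X + 1) ^ k \<le> Y ^ k" by (intro power_mono) auto
    then have "X ^ k + k * X ^ (k - 1) \<le> Y ^ k"
      using power_Suc_diff_ge[of X "k - 1", unfolded kS] by (rule order.trans[rotated])
    then have "int (X ^ k + k * X ^ (k - 1)) \<le> int (Y ^ k)" by (rule of_nat_mono)
    then have "int k * int X ^ (k - 1) \<le> int m * ((int b - int a) * (int d - int c))"
      using diff by (simp add: nm)
    also have "\<dots> \<le> int m * (int b * int d)" using le by (intro mult_left_mono) auto
    finally have 1: "int k * int X ^ (k - 1) \<le> int m * (int b * int d)" .
    have ac: "2 * int m \<le> int a * int c" using neg[OF n0] by (simp flip: of_nat_mult)
    also have "int a * int c \<le> int b * int d" using ab bc cd by (intro mult_mono) auto
    finally have bd: "2 * int m \<le> int b * int d" .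
    have "(int a * int c) * (int b * int d) \<le>
        (2 * (int a * int c + n)) * (2 * (int b * int d + n))"
    proof (rule mult_mono)
      show "int a * int c \<le> 2 * (int a * int c + n)" "int b * int d \<le> 2 * (int b * int d + n)"
        "0 \<le> 2 * (int a * int c + n)" using ac bd nm by simp_all
    qed simp
    then have "int (a * c * (b * d)) \<le> int (4 * X ^ k)" by (simp add: Xk algebra_simps)
    then have "a * c * (b * d) \<le> 4 * X ^ k" by (simp only: of_nat_le_iff)
    then show ?thesis using 1 by blast
  qed
  then obtain Z where "int k * int Z ^ (k - 1) \<le> int m * (int b * int d)"
    and Z2: "a * c * (b * d) \<le> 4 * Z ^ k" by blast
  then have "int (k * Z ^ (k - 1)) \<le> int (m * (b * d))" by simp
  then have Z1: "k * Z ^ (k - 1) \<le> m * (b * d)" by (simp only: of_nat_le_iff)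
  have "(a * c) ^ (k - 1) * (b * d) ^ (k - 1) \<le> (4 * Z ^ k) ^ (k - 1)"
    unfolding power_mult_distrib[symmetric] using Z2 by (intro power_mono) auto
  also have "\<dots> = 4 ^ (k - 1) * (Z ^ (k - 1)) ^ k"
    by (simp add: power_mult_distrib power_mult[symmetric] mult.commute)
  also have "\<dots> \<le> k ^ k * (Z ^ (k - 1)) ^ k"
    using four_power_le_self_power[OF k] by (rule mult_right_mono) simp
  also have "\<dots> = (k * Z ^ (k - 1)) ^ k" by (simp add: power_mult_distrib)
  also have "\<dots> \<le> (m * (b * d)) ^ k" using Z1 by (intro power_mono) auto
  also have "\<dots> = m ^ k * (b * d) * (b * d) ^ (k - 1)"
  proof -
    have "(b * d) ^ k = (b * d) * (b * d) ^ (k - 1)" by (metis kS power_Suc)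
    then show ?thesis by (simp add: power_mult_distrib[of m])
  qed
  finally show ?thesis using ab cd by simp
qed

lemma le_square_if_power_le:
  fixes m a k :: nat
  assumes "0 < a" "0 < k" "m ^ k \<le> a ^ (2 * k - 4)"
  shows "m \<le> a\<^sup>2"
proof -
  have "m ^ k \<le> a ^ (2 * k)"
    using assms by (intro order.trans[OF assms(3)] power_increasing) auto
  also have "\<dots> = (a\<^sup>2) ^ k" by (simp add: power_mult)
  finally show ?thesis using assms by (simp add: power_mono_iff)
qed

text \<open>An increasing enumeration of N large elements. \<open>bound\<close> is the form of L >
  k/(2k-4) that no longer mentions L: |n|^k <= a^(k/L) <= a^(2k-4). Natural roots are possible
  because the products are at least |n|.\<close>

locale power_chain =
  fixes k N :: nat and n :: int and f :: "nat \<Rightarrow> nat"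
  assumes k: "k \<ge> 3" and n: "n \<noteq> 0" and f0: "0 < f 0"
    and inc: "\<And>i j. i < j \<Longrightarrow> j < N \<Longrightarrow> f i < f j"
    and bound: "nat \<bar>n\<bar> ^ k \<le> f 0 ^ (2 * k - 4)"
    and root: "\<And>i j. i < j \<Longrightarrow> j < N \<Longrightarrow> \<exists>z::nat. int z ^ k = int (f i) * int (f j) + n"
begin

definition m :: nat where "m = nat \<bar>n\<bar>"

lemma m_eq: "int m = \<bar>n\<bar>" by (simp add: m_def)

lemma m_le: "m \<le> (f 0)\<^sup>2"
  using le_square_if_power_le[of "f 0" k m] f0 k bound by (simp add: m_def)

text \<open>The roots increase strictly with i. The first is positive since f 0 * f 1 > (f 0)^2 >=
  |n|, and for n > 0 its k-th power is at least 2.\<close>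

lemma root_ge:
  assumes "0 < i" "i < N" "int z ^ k = int (f 0) * int (f i) + n"
  shows "i \<le> z" "n > 0 \<Longrightarrow> i + 1 \<le> z"
proof -
  have "i + (if n > 0 then 1 else 0) \<le> z"
    using assms
  proof (induction i arbitrary: z)
    case (Suc i)
    show ?case
    proof (cases "i = 0")
      case True
      have "int m \<le> int ((f 0)\<^sup>2)" using m_le by (rule of_nat_mono)
      moreover have "int (f 0) * int (f 0) < int (f 0) * int (f 1)"
        using inc[of 0 1] Suc.prems f0 True by simp
      ultimately have "0 < int (f 0) * int (f 1) + n" using m_eq by (simp add: power2_eq_square)
      then have "0 < int z ^ k" using Suc.prems True by simp
      then have z0: "z \<noteq> 0" using k by (auto simp: zero_power)
      have "z \<noteq> 1" if "n > 0"
      proof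
        assume "z = 1"
        moreover have "1 \<le> int (f 0) * int (f 1)"
          using f0 inc[of 0 1] Suc.prems True by (simp add: Suc_leI flip: of_nat_mult)
        ultimately show False using Suc.prems True that by simp
      qed
      then show ?thesis using z0 True by auto
    next
      case False
      obtain y where y: "int y ^ k = int (f 0) * int (f i) + n"
        using root[of 0 i] False Suc.prems by auto
      have IH: "i + (if n > 0 then 1 else 0) \<le> y" using Suc.IH[OF _ _ y] False Suc.prems by auto
      have "int (f 0) * int (f i) < int (f 0) * int (f (Suc i))"
        using inc[of i "Suc i"] Suc.prems f0 by simp
      then have "int y ^ k < int z ^ k" using y Suc.prems by simp
      then have "y < z" by (simp add: power_less_imp_less_base flip: of_nat_power)
      then show ?thesis using IH by auto
    qed
  qed simp
  then show "i \<le> z" "n > 0 \<Longrightarrow> i + 1 \<le> z" by (auto split: if_splits)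
qed

text \<open>The root belonging to \<open>f 3\<close> is at least 3, or 4 when n > 0. In the latter
  case n <= (f 3)^2 costs a factor 2, recovered from 2 * 3^k <= 4^k.\<close>

lemma fourth_ge:
  assumes "3 < N"
  shows "3 ^ k \<le> (f 3)\<^sup>2"
proof -
  obtain z where z: "int z ^ k = int (f 0) * int (f 3) + n" using root[of 0 3] assms by auto
  have f03: "f 0 \<le> f 3" using inc[of 0 3] assms by simp
  show ?thesis
  proof (cases "n > 0")
    case True
    then have "4 \<le> z" using root_ge(2)[OF _ assms z] by simp
    then have "(4::nat) ^ k \<le> z ^ k" by (intro power_mono) auto
    then have "int (4 ^ k) \<le> int (z ^ k)" by (rule of_nat_mono)
    also have "\<dots> = int (f 0 * f 3 + m)" using z m_eq True by simp
    finally have "4 ^ k \<le> f 0 * f 3 + m" by (simp only: of_nat_le_iff)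
    also have "\<dots> \<le> f 3 * f 3 + (f 3)\<^sup>2"
      using f03 order.trans[OF m_le power_mono[OF f03]] by (intro add_mono mult_mono) auto
    finally have "4 ^ k \<le> 2 * (f 3)\<^sup>2" by (simp add: power2_eq_square)
    moreover have "2 * 3 ^ k \<le> (4::nat) ^ k"
      using k by (induction k rule: dec_induct) auto
    ultimately show ?thesis by linarith
  next
    case False
    have "3 \<le> z" using root_ge(1)[OF _ assms z] by simp
    then have "int (3 ^ k) \<le> int (z ^ k)" by (intro of_nat_mono power_mono) auto
    also have "\<dots> \<le> int (f 0 * f 3)" using z False by simp
    also have "\<dots> \<le> int (f 3 * f 3)" using f03 by (intro of_nat_mono mult_mono) auto
    finally show ?thesis by (simp add: power2_eq_square flip: of_nat_mult of_nat_power)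
  qed
qed

text \<open>Were f 0 * f 2 < 2m, \<open>bound\<close> would force (f 0)^4 < 2^k and then m^2 < 2^k.
  But the root of f 0 * f 2 - m is at least 2, so 2^k + m <= f 0 * f 2 < 2m, that is, 2^k <
  m.\<close>

lemma double_m_le:
  assumes neg: "n < 0" and ij: "i < j" "2 \<le> j" "j < N"
  shows "2 * m \<le> f i * f j"
proof (rule ccontr)
  assume "\<not> ?thesis"
  have "f 0 \<le> f i" using inc[of 0 i] ij by (cases "i = 0") auto
  moreover have "f 2 \<le> f j" using inc[of 2 j] ij by (cases "j = 2") auto
  ultimately have "f 0 * f 2 \<le> f i * f j" by (rule mult_mono) auto
  with \<open>\<not> ?thesis\<close> have lt: "f 0 * f 2 < 2 * m" by simp
  have "f 0 * f 0 \<le> f 0 * f 2" using inc[of 0 2] ij by auto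
  then have lt0: "(f 0)\<^sup>2 < 2 * m" using lt unfolding power2_eq_square by linarith
  have bm: "m ^ k \<le> f 0 ^ (2 * k - 4)" using bound by (simp add: m_def)
  have "f 0 ^ 4 * f 0 ^ (2 * k - 4) = ((f 0)\<^sup>2) ^ k"
    using k by (simp flip: power_add power_mult)
  also have "\<dots> < (2 * m) ^ k" using lt0 k by (intro power_strict_mono) auto
  also have "\<dots> \<le> 2 ^ k * f 0 ^ (2 * k - 4)" using bm by (simp add: power_mult_distrib)
  finally have f4: "f 0 ^ 4 < 2 ^ k" by simp
  have "(m\<^sup>2) ^ k = (m ^ k)\<^sup>2" by (simp flip: power_mult add: mult.commute)
  also have "\<dots> \<le> (f 0 ^ (2 * k - 4))\<^sup>2" using bm by (intro power_mono) auto
  also have "\<dots> \<le> (f 0 ^ (2 * k))\<^sup>2" using f0 by (intro power_mono power_increasing) auto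
  also have "\<dots> = (f 0 ^ 4) ^ k" by (simp flip: power_mult)
  also have "\<dots> < (2 ^ k) ^ k" using f4 k by (intro power_strict_mono) auto
  finally have m2: "m\<^sup>2 < 2 ^ k" by (rule power_less_imp_less_base) simp
  obtain z where z: "int z ^ k = int (f 0) * int (f 2) + n" using root[of 0 2] ij by auto
  have "2 \<le> z" using root_ge(1)[OF _ _ z] ij by simp
  then have "int (2 ^ k) \<le> int (z ^ k)" by (intro of_nat_mono power_mono) auto
  then have "int (2 ^ k + m) \<le> int (f 0 * f 2)" using z m_eq neg by simp
  then have "2 ^ k + m \<le> f 0 * f 2" by (simp only: of_nat_le_iff)
  then have "2 ^ k < m" using lt by simp
  also have "m \<le> m\<^sup>2" by (simp add: power2_eq_square)
  finally show False using m2 by simp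
qed

lemma gap:
  assumes "i + 3 < N"
  shows "(f i * f (i + 2)) ^ (k - 1) \<le> m ^ k * (f (i + 1) * f (i + 3))"
proof -
  obtain x1 x2 x3 x4 where "int x1 ^ k = int (f i) * int (f (i + 2)) + n"
    "int x2 ^ k = int (f (i + 1)) * int (f (i + 3)) + n"
    "int x3 ^ k = int (f i) * int (f (i + 3)) + n"
    "int x4 ^ k = int (f (i + 1)) * int (f (i + 2)) + n"
    using root[of i "i + 2"] root[of "i + 1" "i + 3"] root[of i "i + 3"] root[of "i + 1" "i + 2"] assms
    by auto
  moreover have "0 < f i" using f0 inc[of 0 i] assms by (cases "i = 0") auto
  moreover have "f i < f (i + 1)" "f (i + 1) < f (i + 2)" "f (i + 2) < f (i + 3)"
    using inc assms by auto
  moreover have "n < 0 \<Longrightarrow> 2 * m \<le> f i * f (i + 2)" using double_m_le assms by simp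
  ultimately show ?thesis using k n m_eq by (intro gap_principle) auto
qed

end

section \<open>Growth of sequences satisfying the gap inequality\<close>

text \<open>The ratio is available only from index 2 on, so the witnesses are 2+j and 2+2j, one
  block of j steps for each factor.\<close>

lemma growth_by_ratio:
  fixes v :: "nat \<Rightarrow> real"
  assumes v0: "0 \<le> v 0" and mono: "\<And>i. i + 1 < N \<Longrightarrow> v i \<le> v (i + 1)"
    and ratio: "\<And>i. i + 3 < N \<Longrightarrow> \<gamma> * v (i + 2) \<le> v (i + 3)"
    and \<gamma>: "0 \<le> \<gamma>" "26 \<le> \<gamma> ^ j" and N: "2 * j + 3 \<le> N"
  shows "\<exists>p q. p < q \<and> q < N \<and> 26 * v 0 \<le> v p \<and> 17 * v p \<le> v q"
proof -
  have step: "\<gamma> ^ i * v p \<le> v (p + i)" if "2 \<le> p" "p + i < N" for p i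
    using that
  proof (induction i)
    case (Suc i)
    have "\<gamma> ^ Suc i * v p = \<gamma> * (\<gamma> ^ i * v p)" by simp
    also have "\<dots> \<le> \<gamma> * v (p + i)" using Suc \<gamma> by (intro mult_left_mono) auto
    also have "\<dots> \<le> v (p + Suc i)"
    proof -
      have "(p + i - 2) + 2 = p + i" "(p + i - 2) + 3 = p + Suc i" using Suc.prems by auto
      then show ?thesis using ratio[of "p + i - 2"] Suc.prems by (simp only:)
    qed
    finally show ?case .
  qed simp
  have j0: "j > 0" using \<gamma>(2) by (rule contrapos_pp) simp
  have "v 0 \<le> v (0 + 1)" by (rule mono) (use N in linarith)
  also have "v (0 + 1) \<le> v (0 + 1 + 1)" by (rule mono) (use N in linarith)
  finally have v2: "v 0 \<le> v 2" by (simp add: eval_nat_numeral)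
  have "26 * v 0 \<le> \<gamma> ^ j * v 2" using \<gamma> v0 v2 by (intro mult_mono) auto
  also have "\<dots> \<le> v (2 + j)" using step[of 2 j] N by simp
  finally have 1: "26 * v 0 \<le> v (2 + j)" .
  then have "17 * v (2 + j) \<le> \<gamma> ^ j * v (2 + j)" using \<gamma> v0 by (intro mult_right_mono) auto
  also have "\<dots> \<le> v (2 + j + j)" using step[of "2 + j" j] N by simp
  finally show ?thesis using 1 N j0 by (intro exI[of _ "2 + j"] exI[of _ "2 + j + j"]) auto
qed

text \<open>Here v starts at the fourth element; the 4 in \<open>t < real N + 4\<close> is the three
  omitted elements plus the one saved in T - 1. Monotonicity turns the recurrence into a fixed
  ratio: k-2 if s < 2, where the last term is dropped, and k-s otherwise.\<close>

lemma growth_k_ge_4: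
  fixes v :: "nat \<Rightarrow> real" and s L t :: real
  assumes k: "k \<ge> 4" and s: "1 \<le> s" "s < real k - 1" and L: "L = real k / (s + real k - 3)"
    and t: "t = 3 * (ln 18 - ln L) / (ln (real k - 1) - ln s) + 12"
    and v0: "0 \<le> v 0" and mono: "\<And>i. i + 1 < N \<Longrightarrow> v i \<le> v (i + 1)"
    and rec: "\<And>i. i + 3 < N \<Longrightarrow> (real k - 1) * v (i + 2) - v (i + 1) + (2 - s) * v i \<le> v (i + 3)"
    and N: "t < real N + 4"
  shows "\<exists>p q. p < q \<and> q < N \<and> 26 * v 0 \<le> v p \<and> 17 * v p \<le> v q"
proof -
  have vnn: "0 \<le> v i" if "i < N" for i
    using that
  proof (induction i)
    case (Suc i)
    then show ?case using mono[of i] by simp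
  qed (use v0 in simp)
  have k4: "4 \<le> real k" using k by simp
  have L0: "0 < L" using L s k by (auto intro!: divide_pos_pos)
  have q: "18 / L = 18 * (s + real k - 3) / real k" using L s k by simp
  have lnq: "ln 18 - ln L = ln (18 / L)" using L0 by (simp add: ln_div)
  have dpos: "0 < ln (real k - 1) - ln s" using s by simp
  have lower: "12 + c \<le> t" if "c * (ln (real k - 1) - ln s) \<le> 3 * ln (18 / L)" for c
  proof -
    have "c \<le> 3 * (ln 18 - ln L) / (ln (real k - 1) - ln s)"
      using that dpos unfolding lnq by (simp add: pos_le_divide_eq)
    then show ?thesis using t by simp
  qed
  have q9: "9 \<le> 18 / L"
  proof -
    have "9 * real k \<le> 18 * (s + real k - 3)" using k4 s(1) by (simp add: algebra_simps)
    then show ?thesis unfolding q using k by (simp add: field_simps)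
  qed
  have T12: "12 \<le> t" using lower[of 0] q9 by simp
  define \<gamma> where "\<gamma> = (if s < 2 then real k - 2 else real k - s)"
  have g1: "1 < \<gamma>" using k s by (auto simp: \<gamma>_def)
  have ratio: "\<gamma> * v (i + 2) \<le> v (i + 3)" if i: "i + 3 < N" for i
  proof -
    have m: "v i \<le> v (i + 1)" "v (i + 1) \<le> v (i + 2)" "0 \<le> v i"
      using mono[of i] mono[of "i + 1"] vnn i by auto
    show ?thesis
    proof (cases "s < 2")
      case True
      then have "0 \<le> (2 - s) * v i" using m by simp
      then show ?thesis using rec[OF i] m True by (simp add: \<gamma>_def algebra_simps)
    next
      case False
      then have "(s - 2) * v i \<le> (s - 2) * v (i + 2)" using m by (intro mult_left_mono) auto
      then show ?thesis using rec[OF i] m False by (simp add: \<gamma>_def algebra_simps)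
    qed
  qed
  note by_ratio = growth_by_ratio[of v N \<gamma>, OF v0 mono ratio]
  \<comment> \<open>Nine terms are always available and 3^3 = 27 suffices. For ratio at least 2,
    thirteen terms suffice since 2^5 = 32. Below 2 the number of terms must grow like
    1/(\<gamma>-1).\<close>
  consider "3 \<le> \<gamma>" | "2 \<le> \<gamma>" "\<gamma> < 3" | "\<gamma> < 2" by linarith
  then show ?thesis
  proof cases
    case 1
    have "3 ^ 3 \<le> \<gamma> ^ 3" using 1 by (intro power_mono) auto
    then show ?thesis using by_ratio[of 3] T12 N g1 by auto
  next
    case 2
    have "real k - 1 \<le> 3 * s"
    proof (cases "s < 2")
      case True
      then show ?thesis using 2 k s by (simp add: \<gamma>_def)
    next
      case False
      then show ?thesis using 2 by (simp add: \<gamma>_def)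
    qed
    then have "ln (real k - 1) \<le> ln (3 * s)" using k s by (subst ln_le_cancel_iff) auto
    then have "ln (real k - 1) - ln s \<le> ln 3" using s by (simp add: ln_mult)
    moreover have "ln 9 \<le> ln (18 / L)" using q9 L0 by (subst ln_le_cancel_iff) auto
    moreover have "ln 9 = 2 * ln (3::real)" using ln_realpow[of 3 2] by simp
    moreover have "0 < ln (3::real)" by simp
    ultimately have "4 * (ln (real k - 1) - ln s) \<le> 3 * ln (18 / L)"
      unfolding right_diff_distrib by linarith
    then have "16 \<le> t" using lower[of 4] by simp
    moreover have "2 ^ 5 \<le> \<gamma> ^ 5" using 2 by (intro power_mono) auto
    ultimately show ?thesis using by_ratio[of 5] N g1 by auto
  next
    case 3
    \<comment> \<open>In terms of \<open>\<delta>\<close> the denominator of T is at most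
      \<delta>/2, while k >= 4 gives 18/L >= 27/2 >= e^(5/2); so the quotient is at least
      15/\<delta>.\<close>
    define \<delta> where "\<delta> = \<gamma> - 1"
    have s2: "2 \<le> s" using 3 k by (auto simp: \<gamma>_def split: if_splits)
    have d: "0 < \<delta>" "\<delta> < 1" "s = real k - 1 - \<delta>"
      using g1 3 s2 by (auto simp: \<delta>_def \<gamma>_def split: if_splits)
    have "ln ((real k - 1) / s) \<le> (real k - 1) / s - 1" using s by (intro ln_le_minus_one) auto
    also have "\<dots> = \<delta> / s" using d(3) s2 by (simp add: field_simps)
    also have "\<dots> \<le> \<delta> / 2" using d s2 by (intro divide_left_mono) auto
    finally have r: "ln (real k - 1) - ln s \<le> \<delta> / 2" using s by (simp add: ln_div)
    have "27 / 2 * real k \<le> 18 * (s + real k - 3)" using d k4 by (simp add: algebra_simps)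
    then have "27 / 2 \<le> 18 / L" unfolding q using k by (simp add: field_simps)
    moreover have "exp (5 / 2) \<le> (27 / 2 :: real)"
    proof -
      have "exp (5 / 2 :: real) ^ 2 = exp 1 ^ 5" by (simp flip: exp_of_nat_mult)
      also have "\<dots> \<le> (272 / 100) ^ 5" using e_less_272 by (intro power_mono) auto
      also have "\<dots> \<le> (27 / 2) ^ 2" by (simp add: power_divide)
      finally show ?thesis by (rule power2_le_imp_le) simp
    qed
    ultimately have "exp (5 / 2) \<le> 18 / L" by linarith
    then have e: "5 / 2 \<le> ln (18 / L)" using L0 by (subst ln_ge_iff) auto
    have "12 + 15 / \<delta> \<le> t"
    proof (rule lower)
      have "15 / \<delta> * (ln (real k - 1) - ln s) \<le> 15 / \<delta> * (\<delta> / 2)"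
        by (rule mult_left_mono[OF r]) (use d in simp)
      also have "\<dots> = 15 / 2" using d by simp
      finally show "15 / \<delta> * (ln (real k - 1) - ln s) \<le> 3 * ln (18 / L)" using e by linarith
    qed
    \<comment> \<open>By Bernoulli, h steps double the value, so 5h steps multiply it by 32. The 10h
      + 3 terms fit because 5/\<delta> > 5.\<close>
    define h where "h = nat \<lceil>1 / \<delta>\<rceil>"
    have h: "1 / \<delta> \<le> real h" "real h \<le> 1 / \<delta> + 1" using d by (auto simp: h_def)
    have "2 \<le> 1 + real h * \<delta>" using h d by (simp add: field_simps)
    also have "\<dots> \<le> (1 + \<delta>) ^ h" using d by (intro Bernoulli_inequality) auto
    finally have "2 ^ 5 \<le> ((1 + \<delta>) ^ h) ^ 5" by (intro power_mono) auto
    then have "26 \<le> \<gamma> ^ (5 * h)" by (simp add: \<delta>_def power_mult[symmetric] mult.commute)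
    moreover have "1 < 1 / \<delta>" using d by simp
    then have "real (2 * (5 * h) + 3) < real N"
      using h \<open>12 + 15 / \<delta> \<le> t\<close> N by simp
    then have "2 * (5 * h) + 3 \<le> N" by linarith
    ultimately show ?thesis using by_ratio[of "5 * h"] g1 by auto
  qed
qed

text \<open>The recurrence says that each increment exceeds the previous one by at least \<epsilon>
  w(i) >= \<epsilon> w(0). Summing twice gives quadratic growth.\<close>

lemma growth_quadratic:
  fixes w :: "nat \<Rightarrow> real"
  assumes w0: "0 \<le> w 0" and mono: "\<And>i. i + 1 < N \<Longrightarrow> w i \<le> w (i + 1)" and \<epsilon>: "0 \<le> \<epsilon>"
    and rec: "\<And>i. i + 3 < N \<Longrightarrow> 2 * w (i + 2) - w (i + 1) + \<epsilon> * w i \<le> w (i + 3)"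
    and m: "m + 1 < N"
  shows "(1 + \<epsilon> * real m * (real m - 1) / 2) * w 0 \<le> w (m + 1)"
proof -
  have ge: "w 0 \<le> w i" if "i < N" for i
    using that
  proof (induction i)
    case (Suc i)
    then show ?case using mono[of i] by simp
  qed simp
  have diff: "\<epsilon> * real m * w 0 \<le> w (m + 2) - w (m + 1)" if "m + 2 < N" for m
    using that
  proof (induction m)
    case 0
    then show ?case using mono[of 1] by (simp add: numeral_2_eq_2)
  next
    case (Suc m)
    have "\<epsilon> * w 0 \<le> \<epsilon> * w m" using ge[of m] Suc.prems \<epsilon> by (intro mult_left_mono) auto
    moreover have "2 * w (m + 2) - w (m + 1) + \<epsilon> * w m \<le> w (m + 3)" using rec Suc.prems by simp
    moreover have "\<epsilon> * real m * w 0 \<le> w (m + 2) - w (m + 1)" using Suc by simp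
    moreover have "\<epsilon> * real (Suc m) * w 0 = \<epsilon> * real m * w 0 + \<epsilon> * w 0" by (simp add: algebra_simps)
    moreover have "Suc m + 2 = m + 3" "Suc m + 1 = m + 2" by simp_all
    ultimately show ?case by (simp only:)
  qed
  show "(1 + \<epsilon> * real m * (real m - 1) / 2) * w 0 \<le> w (m + 1)"
    using m
  proof (induction m)
    case 0
    then show ?case using ge[of 1] by simp
  next
    case (Suc m)
    have "(1 + \<epsilon> * real (Suc m) * (real (Suc m) - 1) / 2) * w 0
        = (1 + \<epsilon> * real m * (real m - 1) / 2) * w 0 + \<epsilon> * real m * w 0"
      by (simp add: field_simps)
    also have "\<dots> \<le> w (m + 1) + (w (m + 2) - w (m + 1))"
      using Suc diff[of m] by (intro add_mono) auto
    finally show ?case by simp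
  qed
qed

text \<open>Away from s = 2 a bounded number of explicit recurrence steps is enough. Near s = 2 the
  coefficient 2-s is small, and quadratic growth over about 9/(2-s) steps takes over.\<close>

lemma growth_k_eq_3:
  fixes v :: "nat \<Rightarrow> real" and s L t :: real
  assumes s: "1 \<le> s" "s < 2" and L: "L = 3 / s"
    and t: "t = 3 * (ln 18 - ln L) / (ln 2 - ln s) + 12"
    and v0: "0 \<le> v 0" and mono: "\<And>i. i + 1 < N \<Longrightarrow> v i \<le> v (i + 1)"
    and rec: "\<And>i. i + 3 < N \<Longrightarrow> 2 * v (i + 2) - v (i + 1) + (2 - s) * v i \<le> v (i + 3)"
    and N: "t < real N + 4"
  shows "\<exists>p q. p < q \<and> q < N \<and> 26 * v 0 \<le> v p \<and> 17 * v p \<le> v q"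
proof -
  have vnn: "0 \<le> v i" if "i < N" for i
    using that
  proof (induction i)
    case (Suc i)
    then show ?case using mono[of i] by simp
  qed (use v0 in simp)
  have lnq: "ln 18 - ln L = ln (6 * s)"
  proof -
    have "ln 18 - ln L = ln (18 / L)" using L s by (subst ln_div) auto
    also have "18 / L = 6 * s" using L s by simp
    finally show ?thesis .
  qed
  have dpos: "0 < ln 2 - ln s" using s by simp
  have lower: "12 + c \<le> t" if "c * (ln 2 - ln s) \<le> 3 * ln (6 * s)" for c
  proof -
    have "c \<le> 3 * (ln 18 - ln L) / (ln 2 - ln s)"
      using that dpos unfolding lnq by (simp add: pos_le_divide_eq)
    then show ?thesis using t by simp
  qed
  have rec': "2 * v (i + 2) - v (i + 1) + e * v i \<le> v (i + 3)" if "i + 3 < N" "e \<le> 2 - s" for i e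
  proof -
    have "e * v i \<le> (2 - s) * v i" using that vnn[of i] by (intro mult_right_mono) auto
    then show ?thesis using rec[OF that(1)] by linarith
  qed
  consider "s \<le> 57 / 50" | "57 / 50 \<le> s" "s \<le> 29 / 20" | "29 / 20 \<le> s" by linarith
  then show ?thesis
  proof cases
    case 1
    \<comment> \<open>From 128 <= 216 comes t >= 12 + 7, hence sixteen terms: with coefficient
      43/50, eight steps give the factor 26 and seven more give 17.\<close>
    have "ln ((2::real) ^ 7) \<le> ln (6 ^ 3)" by (subst ln_le_cancel_iff) auto
    then have "7 * ln (2::real) \<le> 3 * ln 6"
      by (subst (asm) (1 2) ln_realpow) simp_all
    moreover have "ln 6 \<le> ln (6 * s)" using s by (subst ln_le_cancel_iff) auto
    moreover have "0 \<le> ln s" using s by simp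
    ultimately have "7 * (ln 2 - ln s) \<le> 3 * ln (6 * s)"
      unfolding right_diff_distrib by linarith
    then have "19 \<le> t" using lower[of 7] by simp
    then have N16: "16 \<le> N" using N by linarith
    have R: "2 * v (i + 2) - v (i + 1) + 43 / 50 * v i \<le> v (i + 3)" if "i + 3 < N" for i
      using rec'[of i "43 / 50"] that 1 by simp
    have "26 * v 0 \<le> v 8"
      using R[of 0] R[of 1] R[of 2] R[of 3] R[of 4] R[of 5] mono[of 0] mono[of 1] N16 v0
      by (simp add: eval_nat_numeral)
    moreover have "17 * v 8 \<le> v 15"
      using R[of 8] R[of 9] R[of 10] R[of 11] R[of 12] mono[of 8] mono[of 9] N16 vnn[of 8]
      by (simp add: eval_nat_numeral)
    ultimately show ?thesis using N16 by (intro exI[of _ 8] exI[of _ 15]) auto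
  next
    case 2
    \<comment> \<open>This gives t >= 12 + 9, hence eighteen terms: nine and eight steps with
      coefficient 11/20.\<close>
    have "(2 / s) ^ 3 \<le> (2 / (57 / 50)) ^ 3" using 2 by (intro power_mono divide_left_mono) auto
    also have "\<dots> \<le> 6" by (simp add: power_divide)
    also have "\<dots> \<le> 6 * s" using s by simp
    finally have "ln ((2 / s) ^ 3) \<le> ln (6 * s)" using s by (subst ln_le_cancel_iff) auto
    then have "3 * (ln 2 - ln s) \<le> ln (6 * s)" using s by (simp add: ln_realpow ln_div)
    then have "21 \<le> t" using lower[of 9] by simp
    then have N18: "18 \<le> N" using N by linarith
    have R: "2 * v (i + 2) - v (i + 1) + 11 / 20 * v i \<le> v (i + 3)" if "i + 3 < N" for i
      using rec'[of i "11 / 20"] that 2 by simp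
    have "26 * v 0 \<le> v 9"
      using R[of 0] R[of 1] R[of 2] R[of 3] R[of 4] R[of 5] R[of 6] mono[of 0] mono[of 1] N18 v0
      by (simp add: eval_nat_numeral)
    moreover have "17 * v 9 \<le> v 17"
      using R[of 9] R[of 10] R[of 11] R[of 12] R[of 13] R[of 14] mono[of 9] mono[of 10] N18 vnn[of 9]
      by (simp add: eval_nat_numeral)
    ultimately show ?thesis using N18 by (intro exI[of _ 9] exI[of _ 17]) auto
  next
    case 3
    define \<epsilon> where "\<epsilon> = 2 - s"
    have e: "0 < \<epsilon>" "\<epsilon> \<le> 11 / 20" using s 3 by (auto simp: \<epsilon>_def)
    \<comment> \<open>Chosen so that 6s >= 87/10 yields 3 ln(6s) >= 63/10, just above the 180/29
      needed for 9/\<epsilon> further terms.\<close>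
    have "exp (21 / 10) \<le> (87 / 10 :: real)"
    proof -
      have "exp (21 / 10 :: real) ^ 10 = exp 1 ^ 21" by (simp flip: exp_of_nat_mult)
      also have "\<dots> \<le> (272 / 100) ^ 21" using e_less_272 by (intro power_mono) auto
      also have "\<dots> \<le> (87 / 10) ^ 10" by (simp add: power_divide)
      finally show ?thesis using power_le_imp_le_base[of "exp (21 / 10 :: real)" 9 "87 / 10"] by simp
    qed
    also have "\<dots> \<le> 6 * s" using 3 by simp
    finally have q: "21 / 10 \<le> ln (6 * s)" using s by (subst ln_ge_iff) auto
    have "ln (2 / s) \<le> 2 / s - 1" using s by (intro ln_le_minus_one) auto
    also have "\<dots> = \<epsilon> / s" using s by (simp add: \<epsilon>_def field_simps)
    also have "\<dots> \<le> \<epsilon> / (29 / 20)" using e 3 by (intro divide_left_mono) auto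
    finally have r: "ln 2 - ln s \<le> \<epsilon> / (29 / 20)" using s by (simp add: ln_div)
    have "12 + 9 / \<epsilon> \<le> t"
    proof (rule lower)
      have "9 / \<epsilon> * (ln 2 - ln s) \<le> 9 / \<epsilon> * (\<epsilon> / (29 / 20))"
        by (rule mult_left_mono[OF r]) (use e in simp)
      also have "\<dots> = 180 / 29" using e by simp
      finally show "9 / \<epsilon> * (ln 2 - ln s) \<le> 3 * ln (6 * s)" using q by linarith
    qed
    then have NN: "8 + 9 / \<epsilon> < real N" using N by linarith
    \<comment> \<open>The quadratic bounds become 1 + (25/\<epsilon> + 5)/2 and 1 + (16/\<epsilon> +
      4)/2. These reach 26 and 17 because \<epsilon> <= 11/20, which is what the threshold 29/20 for
      s provides.\<close>
    define h1 h2 where "h1 = nat \<lceil>5 / \<epsilon>\<rceil>" and "h2 = nat \<lceil>4 / \<epsilon>\<rceil>"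
    have h1: "5 / \<epsilon> \<le> real h1" "real h1 \<le> 5 / \<epsilon> + 1" using e by (auto simp: h1_def)
    have h2: "4 / \<epsilon> \<le> real h2" "real h2 \<le> 4 / \<epsilon> + 1" using e by (auto simp: h2_def)
    have "9 / \<epsilon> = 5 / \<epsilon> + 4 / \<epsilon>" by (simp flip: add_divide_distrib)
    then have "real (h1 + h2 + 5) < real N" using NN h1 h2 by simp
    then have NB: "h1 + h2 + 5 < N" by linarith
    have ie: "20 / 11 \<le> 1 / \<epsilon>" using e by (simp add: field_simps)
    have E1: "26 \<le> 1 + \<epsilon> * real (h1 + 1) * (real (h1 + 1) - 1) / 2"
    proof -
      have "\<epsilon> * ((5 / \<epsilon> + 1) * (5 / \<epsilon>)) \<le> \<epsilon> * (real (h1 + 1) * (real (h1 + 1) - 1))"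
        using h1 e by (intro mult_left_mono mult_mono) auto
      moreover have "\<epsilon> * ((5 / \<epsilon> + 1) * (5 / \<epsilon>)) = 25 * (1 / \<epsilon>) + 5" using e by (simp add: field_simps)
      ultimately show ?thesis using ie by (simp add: mult.assoc)
    qed
    have E2: "17 \<le> 1 + \<epsilon> * real (h2 + 1) * (real (h2 + 1) - 1) / 2"
    proof -
      have "\<epsilon> * ((4 / \<epsilon> + 1) * (4 / \<epsilon>)) \<le> \<epsilon> * (real (h2 + 1) * (real (h2 + 1) - 1))"
        using h2 e by (intro mult_left_mono mult_mono) auto
      moreover have "\<epsilon> * ((4 / \<epsilon> + 1) * (4 / \<epsilon>)) = 16 * (1 / \<epsilon>) + 4" using e by (simp add: field_simps)
      ultimately show ?thesis using ie by (simp add: mult.assoc)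
    qed
    define p q where "p = h1 + 2" and "q = h1 + 2 + (h2 + 2)"
    have "26 * v 0 \<le> (1 + \<epsilon> * real (h1 + 1) * (real (h1 + 1) - 1) / 2) * v 0"
      by (rule mult_right_mono[OF E1 v0])
    also have "\<dots> \<le> v (h1 + 1 + 1)"
      by (rule growth_quadratic[where N = N]) (use v0 mono rec e NB in \<open>auto simp: \<epsilon>_def\<close>)
    finally have 1: "26 * v 0 \<le> v p" by (simp add: p_def)
    have vp: "0 \<le> v p" using vnn NB by (simp add: p_def)
    have "17 * v p \<le> (1 + \<epsilon> * real (h2 + 1) * (real (h2 + 1) - 1) / 2) * v (p + 0)"
      using mult_right_mono[OF E2 vp] by simp
    also have "\<dots> \<le> v (p + (h2 + 1 + 1))"
    proof (rule growth_quadratic[of "\<lambda>i. v (p + i)" "N - p"])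
      show "2 * v (p + (i + 2)) - v (p + (i + 1)) + \<epsilon> * v (p + i) \<le> v (p + (i + 3))" if "i + 3 < N - p" for i
        using rec[of "p + i"] that by (simp add: \<epsilon>_def add.assoc)
      show "v (p + i) \<le> v (p + (i + 1))" if "i + 1 < N - p" for i
        using mono[of "p + i"] that by simp
    qed (use vp e NB in \<open>auto simp: p_def\<close>)
    finally have 2: "17 * v p \<le> v q" by (simp add: p_def q_def)
    show ?thesis using 1 2 NB by (intro exI[of _ p] exI[of _ q]) (auto simp: p_def q_def)
  qed
qed

section \<open>Large and small elements\<close>

lemma (in power_chain) no_fast_growth:
  assumes p: "3 < p" "p < q" "q < N" and grow: "f 3 ^ 26 \<le> f p" "f p ^ 17 \<le> f q"
  shows False
proof -
  obtain x y x' y' where "int x ^ k = int (f 0) * int (f p) + n"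
    "int y ^ k = int (f 3) * int (f p) + n" "int x' ^ k = int (f 0) * int (f q) + n"
    "int y' ^ k = int (f 3) * int (f q) + n"
    using root[of 0 p] root[of 3 p] root[of 0 q] root[of 3 q] p by auto
  moreover have "f 0 < f 3" using inc[of 0 3] p by simp
  moreover have "\<bar>n\<bar> \<le> (int (f 0))\<^sup>2"
    unfolding m_eq[symmetric] using m_le by (simp flip: of_nat_power)
  moreover have "3 ^ k \<le> (f 3)\<^sup>2" using fourth_ge p by simp
  ultimately show False
    using no_two_distant_solutions[of k "f 0" "f 3" n "f p" "f q" x y x' y'] k f0 n grow by blast
qed

text \<open>\<open>s\<close> is chosen so that 2-s is the lowest coefficient of the logarithmic gap
  inequality. Clearing denominators, each bound on L becomes one bound on s.\<close>

lemma exponent_range: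
  fixes k :: nat and L :: real
  assumes k: "k \<ge> 3" and L: "real k / (2 * real k - 4) < L" "L \<le> real k / (real k - 2)"
  defines "s \<equiv> 3 + real k / L - real k"
  shows "0 < L" "1 \<le> s" "s < real k - 1" "L = real k / (s + real k - 3)" "12 \<le> T k L"
proof -
  have k3: "3 \<le> real k" using k by simp
  have "0 < real k / (2 * real k - 4)" using k3 by (intro divide_pos_pos) auto
  then show L0: "0 < L" using L by linarith
  have "real k < L * (2 * real k - 4)" using L(1) k3 by (simp add: pos_divide_less_eq)
  then have "real k / L < 2 * real k - 4" using L0 by (simp add: field_simps)
  then show s2: "s < real k - 1" by (simp add: s_def)
  have "L * (real k - 2) \<le> real k" using L(2) k3 by (simp add: pos_le_divide_eq)
  then have "real k - 2 \<le> real k / L" using L0 by (simp add: field_simps)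
  then show s1: "1 \<le> s" by (simp add: s_def)
  show "L = real k / (s + real k - 3)" using L0 k3 by (simp add: s_def)
  have "real k / (real k - 2) \<le> 3" using k3 by (simp add: field_simps)
  then have "ln L \<le> ln 18" using L L0 by (subst ln_le_cancel_iff) auto
  moreover have "ln s \<le> ln (real k - 1)" using s1 s2 by (subst ln_le_cancel_iff) auto
  ultimately show "12 \<le> T k L" by (simp add: T_def s_def)
qed

lemma (in power_chain) length_bound:
  fixes L :: real
  assumes L: "real k / (2 * real k - 4) < L" "L \<le> real k / (real k - 2)"
    and large: "\<And>i. i < N \<Longrightarrow> real m powr L \<le> real (f i)"
  shows "real N \<le> T k L - 1"
proof (rule ccontr)
  assume "\<not> ?thesis"
  then have NT: "T k L < real N + 1" by simp
  define s where "s = 3 + real k / L - real k"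
  note range = exponent_range[OF k L, folded s_def]
  have N11: "11 < N" using NT range(5) by linarith
  have fpos: "0 < f i" if "i < N" for i using f0 inc[of 0 i] that by (cases "i = 0") auto
  have m0: "0 < m" using n by (simp add: m_def)
  define u where "u i = ln (real (f i))" for i
  have rec: "(real k - 1) * u (i + 2) - u (i + 1) + (2 - s) * u i \<le> u (i + 3)" if i: "i + 3 < N" for i
  proof -
    have pos: "0 < real (f i)" "0 < real (f (i + 1))" "0 < real (f (i + 2))" "0 < real (f (i + 3))"
      using fpos i by auto
    have "real ((f i * f (i + 2)) ^ (k - 1)) \<le> real (m ^ k * (f (i + 1) * f (i + 3)))"
      using gap[OF i] by (rule of_nat_mono)
    then have "(real (f i) * real (f (i + 2))) ^ (k - 1) \<le>
        real m ^ k * (real (f (i + 1)) * real (f (i + 3)))"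
      by (simp only: of_nat_mult of_nat_power)
    then have "ln ((real (f i) * real (f (i + 2))) ^ (k - 1)) \<le>
        ln (real m ^ k * (real (f (i + 1)) * real (f (i + 3))))"
      using pos m0 by (subst ln_le_cancel_iff) auto
    moreover have "ln ((real (f i) * real (f (i + 2))) ^ (k - 1)) = (real k - 1) * (u i + u (i + 2))"
      using pos k by (simp add: ln_realpow ln_mult u_def of_nat_diff)
    moreover have "ln (real m ^ k * (real (f (i + 1)) * real (f (i + 3)))) =
        real k * ln (real m) + (u (i + 1) + u (i + 3))"
      using pos m0 by (simp add: ln_realpow ln_mult u_def)
    \<comment> \<open>Largeness of \<open>f i\<close> replaces the term in |n| by (k/L) u(i); with
      k-1 - k/L = 2-s the inequality becomes a homogeneous recurrence.\<close>
    moreover have "real k * ln (real m) \<le> real k / L * u i"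
    proof -
      have "ln (real m powr L) \<le> u i"
        unfolding u_def using large[of i] i pos m0 by (subst ln_le_cancel_iff) auto
      then have "L * ln (real m) \<le> u i" using m0 by (simp add: ln_powr)
      then have "real k / L * (L * ln (real m)) \<le> real k / L * u i"
        using range(1) by (intro mult_left_mono) auto
      then show ?thesis using range(1) by simp
    qed
    ultimately have "(real k - 1) * (u i + u (i + 2)) \<le> real k / L * u i + (u (i + 1) + u (i + 3))"
      by linarith
    then show ?thesis by (simp add: s_def algebra_simps)
  qed
  \<comment> \<open>The shift puts the fourth element at index 0, so the growth factors 26 and 17
    become powers starting from \<open>f 3\<close>.\<close>
  define v where "v i = u (3 + i)" for i
  have mono: "v i \<le> v (i + 1)" if "i + 1 < N - 3" for i
  proof -
    have "f (3 + i) < f (3 + (i + 1))" using inc that by simp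
    then show ?thesis unfolding v_def u_def using fpos[of "3 + i"] that by simp
  qed
  have vrec: "(real k - 1) * v (i + 2) - v (i + 1) + (2 - s) * v i \<le> v (i + 3)" if "i + 3 < N - 3" for i
    using rec[of "3 + i"] that unfolding v_def by (simp only: add.assoc)
  have "3 ^ k \<le> (f 3)\<^sup>2" using fourth_ge N11 by simp
  then have "6 \<le> f 3" using size_constants(1) k by blast
  then have v0: "0 < v 0" by (simp add: v_def u_def)
  have N3: "T k L < real (N - 3) + 4" using NT N11 by (simp add: of_nat_diff)
  have "\<exists>p q. p < q \<and> q < N - 3 \<and> 26 * v 0 \<le> v p \<and> 17 * v p \<le> v q"
  proof (cases "k = 3")
    case True
    show ?thesis
    proof (rule growth_k_eq_3[where s = s and L = L and t = "T k L"])
      show "L = 3 / s" using range(4) True by simp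
      show "T k L = 3 * (ln 18 - ln L) / (ln 2 - ln s) + 12" by (simp add: T_def s_def True)
      show "2 * v (i + 2) - v (i + 1) + (2 - s) * v i \<le> v (i + 3)" if "i + 3 < N - 3" for i
        using vrec[OF that] True by simp
    qed (use range True mono v0 N3 in auto)
  next
    case False
    show ?thesis
    proof (rule growth_k_ge_4[where s = s and L = L and t = "T k L" and k = k])
      show "T k L = 3 * (ln 18 - ln L) / (ln (real k - 1) - ln s) + 12" by (simp add: T_def s_def)
    qed (use range False mono v0 N3 k vrec in auto)
  qed
  then obtain p q where pq: "p < q" "q < N - 3" "26 * v 0 \<le> v p" "17 * v p \<le> v q" by blast
  \<comment> \<open>Positivity of \<open>v 0\<close>, that is f 3 > 1, separates b from c.\<close>
  have "p \<noteq> 0" using pq(3) v0 by (intro notI) simp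
  have up: "a ^ j \<le> b" if "real j * ln (real a) \<le> ln (real b)" "0 < a" "0 < b" for a b j
  proof -
    have "ln (real (a ^ j)) \<le> ln (real b)" using that by (simp add: ln_realpow)
    then have "real (a ^ j) \<le> real b" using that by (subst (asm) ln_le_cancel_iff) auto
    then show ?thesis by (simp only: of_nat_le_iff)
  qed
  have "f 3 ^ 26 \<le> f (3 + p)" "f (3 + p) ^ 17 \<le> f (3 + q)"
    using pq fpos by (auto intro!: up simp: v_def u_def)
  moreover have "3 < 3 + p" "3 + p < 3 + q" "3 + q < N" using pq(1,2) \<open>p \<noteq> 0\<close> by linarith+
  ultimately show False using no_fast_growth by blast
qed

lemma card_large_elements:
  fixes k :: nat and L :: real and n :: int
  assumes k: "k \<ge> 3" and L: "real k / (2 * real k - 4) < L" "L \<le> real k / (real k - 2)"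
    and n: "n \<noteq> 0" and D: "property_D k n C"
    and S: "finite S" "S \<subseteq> C" "\<And>c. c \<in> S \<Longrightarrow> real_of_int \<bar>n\<bar> powr L \<le> real c"
  shows "real (card S) \<le> T k L - 1"
proof (cases "S = {}")
  case True
  then show ?thesis using exponent_range(5)[OF k L] by simp
next
  case False
  define N where "N = card S"
  define f where "f i = sorted_list_of_set S ! i" for i
  have N0: "0 < N" using False S by (simp add: N_def card_gt_0_iff)
  have fS: "f i \<in> S" if "i < N" for i
    using that S nth_mem[of i "sorted_list_of_set S"] by (simp add: f_def N_def)
  have inc: "f i < f j" if "i < j" "j < N" for i j
    using that S strict_sorted_list_of_set[of S] by (simp add: f_def N_def sorted_wrt_nth_less)
  have f0: "0 < f 0" using D fS[OF N0] S by (auto simp: property_D_def)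
  have absn: "real_of_int \<bar>n\<bar> = real (nat \<bar>n\<bar>)" by simp
  have n1: "1 \<le> real (nat \<bar>n\<bar>)" using n by simp
  have L0: "0 < L" using exponent_range(1)[OF k L] .
  have kL: "real k / L < 2 * real k - 4"
    using exponent_range(3)[OF k L] by simp
  have bound: "nat \<bar>n\<bar> ^ k \<le> f 0 ^ (2 * k - 4)"
  proof -
    have "real (nat \<bar>n\<bar>) ^ k = (real (nat \<bar>n\<bar>) powr L) powr (real k / L)"
      using n1 L0 by (simp add: powr_powr powr_realpow)
    also have "\<dots> \<le> real (f 0) powr (real k / L)"
      using S(3)[OF fS[OF N0]] L0 absn by (intro powr_mono2) auto
    also have "\<dots> \<le> real (f 0) powr (2 * real k - 4)"
      using kL f0 by (intro powr_mono) auto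
    also have "2 * real k - 4 = real (2 * k - 4)" using k by (simp add: of_nat_diff)
    also have "real (f 0) powr \<dots> = real (f 0) ^ (2 * k - 4)" using f0 by (simp add: powr_realpow)
    finally have "real (nat \<bar>n\<bar> ^ k) \<le> real (f 0 ^ (2 * k - 4))" by simp
    then show ?thesis by (simp only: of_nat_le_iff)
  qed
  interpret power_chain k N n f
  proof
    fix i j assume ij: "i < j" "j < N"
    then have "f i \<in> C" "f j \<in> C" "f i \<noteq> f j" using fS[of i] fS[of j] S inc[OF ij] by auto
    then obtain z :: int where z: "int (f i) * int (f j) + n = z ^ k"
      using D unfolding property_D_def by blast
    have fi: "f 0 \<le> f i" using inc[of 0 i] ij by (cases "i = 0") auto
    \<comment> \<open>Makes every product plus n nonnegative, so the sign of a root can be discarded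
      even for odd k.\<close>
    have "nat \<bar>n\<bar> \<le> (f 0)\<^sup>2" 
      by (rule le_square_if_power_le[of _ k]) (use f0 k bound in auto)
    also have "\<dots> \<le> f i * f i" using fi by (simp add: power2_eq_square mult_mono)
    also have "\<dots> \<le> f i * f j" using inc[OF ij] by simp
    finally have "0 \<le> int (f i) * int (f j) + n" by (simp flip: of_nat_mult)
    then have "int (nat \<bar>z\<bar>) ^ k = int (f i) * int (f j) + n"
      unfolding z by (simp flip: power_abs)
    then show "\<exists>z::nat. int z ^ k = int (f i) * int (f j) + n" by blast
  qed (use k n f0 inc bound in auto)
  have "real N \<le> T k L - 1"
    by (rule length_bound[OF L]) (use S(3) fS absn in \<open>simp add: m_def\<close>)
  then show ?thesis by (simp add: N_def)
qed

section \<open>Elements below the threshold |n|^L\<close>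

lemma le_root_if_power_le:
  fixes z :: nat
  assumes "real z ^ k \<le> y" "0 < k"
  shows "real z \<le> y powr (1 / real k)"
proof (cases "z = 0")
  case False
  then have "real z = (real z ^ k) powr (1 / real k)" using assms by (simp add: power_root_powr)
  also have "\<dots> \<le> y powr (1 / real k)" using assms by (intro powr_mono2) auto
  finally show ?thesis .
qed simp

text \<open>If \<open>z\<close> and \<open>-z\<close> both occur, a prime factor of \<open>gcd e z\<close> divides all roots, which halves the number
  of candidates and makes room for the negative ones.\<close>

lemma card_signed_roots_le:
  fixes e k R :: nat and n :: int and Z :: "int set"
  assumes e: "e \<ge> 3" and Z: "\<And>z. z \<in> Z \<Longrightarrow> int e dvd z ^ k - n"
    and nonneg: "\<And>z. even k \<Longrightarrow> z \<in> Z \<Longrightarrow> 0 \<le> z"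
    and R: "\<And>z. z \<in> Z \<Longrightarrow> z \<noteq> 0 \<Longrightarrow> \<bar>z\<bar> \<le> int R"
  shows "card (Z - {0}) \<le> R"
proof -
  have "\<exists>\<phi>. inj_on \<phi> (Z - {0}) \<and> \<phi> ` (Z - {0}) \<subseteq> {1..int R}"
  proof (cases "\<exists>z\<in>Z. - z \<in> Z \<and> z > 0")
    case False
    have "inj_on abs (Z - {0})"
    proof (rule inj_onI)
      fix x y assume xy: "x \<in> Z - {0}" "y \<in> Z - {0}" "\<bar>x\<bar> = \<bar>y\<bar>"
      then have "x = y \<or> x = - y" by linarith
      moreover have "x \<noteq> - y"
      proof
        assume "x = - y"
        then show False using xy False by (cases "x > 0") auto
      qed
      ultimately show "x = y" by blast
    qed
    moreover have "abs ` (Z - {0}) \<subseteq> {1..int R}" using R by auto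
    ultimately show ?thesis by blast
  next
    case True
    then obtain z where z: "z \<in> Z" "- z \<in> Z" "z > 0" by blast
    then have "odd k" using nonneg[of "- z"] by auto
    have "int e dvd (z ^ k - n) - ((- z) ^ k - n)" by (rule dvd_diff[OF Z[OF z(1)] Z[OF z(2)]])
    also have "(z ^ k - n) - ((- z) ^ k - n) = 2 * z ^ k" using \<open>odd k\<close> by simp
    finally have "int e dvd 2 * z ^ k" .
    \<comment> \<open>Opposite roots give e | 2z^k; coprimality would leave e | 2, excluded by e >=
      3.\<close>
    have "\<not> coprime (int e) z"
    proof
      assume "coprime (int e) z"
      then have "coprime (int e) (z ^ k)" by simp
      then have "int e dvd 2" using \<open>int e dvd 2 * z ^ k\<close> by (simp add: coprime_dvd_mult_left_iff)
      then have "int e \<le> 2" by (rule zdvd_imp_le) simp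
      then show False using e by simp
    qed
    then have "\<not> is_unit (gcd (int e) z)" by (simp add: coprime_iff_gcd_eq_1)
    then obtain p where p: "prime p" "p dvd gcd (int e) z"
      using prime_divisor_exists[of "gcd (int e) z"] e by auto
    have dvd: "p dvd w" if "w \<in> Z" for w
    proof -
      have pe: "p dvd int e" "p dvd z" using p(2) by auto
      have "p dvd (w ^ k - n) - (z ^ k - n)"
        by (rule dvd_diff[OF dvd_trans[OF pe(1) Z[OF that]] dvd_trans[OF pe(1) Z[OF z(1)]]])
      moreover have "p dvd z ^ k"
        using \<open>odd k\<close> by (intro dvd_trans[OF pe(2)] dvd_power) (simp add: odd_pos)
      ultimately have "p dvd ((w ^ k - n) - (z ^ k - n)) + z ^ k" by (rule dvd_add)
      then have "p dvd w ^ k" by simp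
      then show ?thesis using p(1) by (metis prime_dvd_power)
    qed
    have p2: "2 \<le> p" using p(1) by (rule prime_ge_2_int)
    have mult: "2 \<le> \<bar>w\<bar>" if "w \<in> Z - {0}" for w
    proof -
      have "p \<le> \<bar>w\<bar>" using dvd[of w] that by (intro zdvd_imp_le) auto
      then show ?thesis using p2 by simp
    qed
    \<comment> \<open>Negative roots are moved by one so that they avoid the positive ones: a
      collision would make p divide 1. Since every nonzero root has absolute value at least 2, the
      values stay in 1..R.\<close>
    define \<phi> where "\<phi> w = (if w > 0 then w else - w - 1)" for w :: int
    have neq: "w \<noteq> - w' - 1" if "w \<in> Z" "w' \<in> Z" for w w'
    proof
      assume "w = - w' - 1"
      then have "p dvd - (w + w')" using dvd that by (subst dvd_minus_iff) (intro dvd_add, auto)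
      with \<open>w = - w' - 1\<close> have "p dvd 1" by simp
      then show False using p(1) not_prime_unit by blast
    qed
    have "inj_on \<phi> (Z - {0})"
    proof (rule inj_onI)
      fix x y assume xy: "x \<in> Z - {0}" "y \<in> Z - {0}" "\<phi> x = \<phi> y"
      then show "x = y" using neq[of x y] neq[of y x] by (auto simp: \<phi>_def split: if_splits)
    qed
    moreover have "\<phi> ` (Z - {0}) \<subseteq> {1..int R}"
    proof (rule image_subsetI)
      fix w assume "w \<in> Z - {0}"
      then show "\<phi> w \<in> {1..int R}" using mult[of w] R[of w] by (auto simp: \<phi>_def)
    qed
    ultimately show ?thesis by blast
  qed
  then obtain \<phi> where "inj_on \<phi> (Z - {0})" "\<phi> ` (Z - {0}) \<subseteq> {1..int R}" by blast
  then have "card (Z - {0}) \<le> card {1..int R}" by (rule card_inj_on_le) simp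
  then show ?thesis by simp
qed

lemma card_small_elements:
  fixes k :: nat and L :: real and n :: int
  assumes k: "k \<ge> 3" and L: "real k / (2 * real k - 4) < L" and D: "property_D k n C"
  defines "S \<equiv> {c \<in> C. real c < real_of_int \<bar>n\<bar> powr L}"
    and "X \<equiv> (real_of_int \<bar>n\<bar> powr (2 * L) + real_of_int n) powr (1 / real k)"
  shows "finite S" "real (card S) \<le> X + 2"
proof -
  define m where "m = real_of_int \<bar>n\<bar>"
  have "S \<subseteq> {..nat \<lfloor>m powr L\<rfloor>}" unfolding S_def m_def by (auto simp: le_nat_floor)
  then show fin: "finite S" by (rule finite_subset) simp
  have X0: "0 \<le> X" by (simp add: X_def)
  show "real (card S) \<le> X + 2"
  proof (cases "card S \<le> 2")
    case True
    then show ?thesis using X0 by simp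
  next
    case False
    have pos: "0 < c" if "c \<in> S" for c using that D by (auto simp: S_def property_D_def)
    have S0: "S \<noteq> {}" using False by auto
    define e where "e = Max S"
    have eS: "e \<in> S" using fin S0 by (simp add: e_def)
    have "S \<subseteq> {1..e}" using fin pos by (auto simp: e_def Suc_leI)
    then have "card S \<le> e" using card_mono[of "{1..e}" S] by simp
    then have e3: "e \<ge> 3" using False by simp
    have "\<exists>z. z ^ k = int e * int c + n \<and> (even k \<longrightarrow> 0 \<le> z)" if "c \<in> S - {e}" for c
    proof -
      have "e \<in> C" "c \<in> C" "e \<noteq> c" using that eS by (auto simp: S_def)
      then obtain z :: int where z: "int e * int c + n = z ^ k"
        using D unfolding property_D_def by blast
      show ?thesis
      proof (cases "even k")
        case True
        then show ?thesis by (intro exI[of _ "\<bar>z\<bar>"]) (simp add: z power_even_abs)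
      next
        case False
        then show ?thesis by (intro exI[of _ z]) (simp add: z)
      qed
    qed
    then obtain z where z: "\<And>c. c \<in> S - {e} \<Longrightarrow> z c ^ k = int e * int c + n"
      and znn: "\<And>c. c \<in> S - {e} \<Longrightarrow> even k \<Longrightarrow> 0 \<le> z c" by metis
    define Z where "Z = z ` (S - {e})"
    have "inj_on z (S - {e})"
    proof (rule inj_onI)
      fix c c' assume c: "c \<in> S - {e}" "c' \<in> S - {e}" "z c = z c'"
      then have "int e * int c + n = int e * int c' + n" by (metis z)
      then show "c = c'" using e3 by simp
    qed
    then have cardZ: "card S = card Z + 1" using fin eS S0 by (simp add: Z_def card_image card_Diff_singleton card_gt_0_iff Suc_leI)
    have finZ: "finite Z" using fin by (simp add: Z_def)
    have upper: "real e * real c \<le> m powr (2 * L)" if "c \<in> S" for c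
    proof -
      have "real e * real c \<le> m powr L * m powr L"
        using that eS by (intro mult_mono) (auto simp: S_def m_def)
      then show ?thesis by (simp flip: powr_add)
    qed
    have sz: "\<bar>w\<bar> \<le> \<lfloor>X\<rfloor> \<or> w = -1" if wZ: "w \<in> Z" for w
    proof -
      obtain c where c: "c \<in> S - {e}" "w = z c" using wZ by (auto simp: Z_def)
      have wk: "w ^ k = int e * int c + n" using z c by simp
      consider "w = 0" | "w > 0" | "w < 0" by linarith
      then show ?thesis
      proof cases
        case 1
        then show ?thesis using X0 by simp
      next
        case 2
        have "real (nat w) ^ k = real_of_int (w ^ k)" using 2 by simp
        also have "\<dots> = real e * real c + real_of_int n" by (simp add: wk)
        also have "\<dots> \<le> m powr (2 * L) + real_of_int n" using upper c by simp
        finally have "real (nat w) \<le> X" unfolding X_def m_def using k by (intro le_root_if_power_le) auto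
        then show ?thesis using 2 by (simp add: le_floor_iff)
      next
        case 3
        then have "odd k" using znn c by force
        then have "w ^ k < 0" using 3 by simp
        then have neg: "n < 0" using wk by (smt (verit) mult_nonneg_nonneg of_nat_0_le_iff)
        have "0 < int e * int c" using e3 pos c by simp
        have "\<bar>w\<bar> ^ k = - (w ^ k)" using 3 \<open>odd k\<close> by simp
        then have "\<bar>w\<bar> ^ k < \<bar>n\<bar>" using wk neg \<open>0 < int e * int c\<close> by simp
        then have "real_of_int (\<bar>w\<bar> ^ k) < m" unfolding m_def by (rule of_int_less_iff[THEN iffD2])
        then have wm: "real (nat \<bar>w\<bar>) ^ k < m" by simp
        show ?thesis
        \<comment> \<open>A negative root is only known to satisfy |w|^k < |n|, which suffices if
          |n| <= |n|^(2L) + n. Otherwise 2L > k/(k-2) forces |n| <= 2^k, leaving only w =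
          -1.\<close>
        proof (cases "2 * m \<le> m powr (2 * L)")
          case True
          then have "real (nat \<bar>w\<bar>) ^ k \<le> m powr (2 * L) + real_of_int n"
            using wm neg by (simp add: m_def)
          then have "real (nat \<bar>w\<bar>) \<le> X" unfolding X_def m_def using k by (intro le_root_if_power_le) auto
          then show ?thesis by (simp add: le_floor_iff)
        next
          case False
          have m1: "1 \<le> m" using neg by (simp add: m_def)
          have k3: "3 \<le> real k" using k by simp
          have "real k / (real k - 2) = 2 * (real k / (2 * real k - 4))"
            using k3 by (simp add: field_simps)
          then have "m powr (real k / (real k - 2)) \<le> m powr (2 * L)" using L m1 by (intro powr_mono) auto
          then have "m powr (real k / (real k - 2)) < 2 * m" using False by simp
          moreover have "real k / (real k - 2) = 1 + 2 / (real k - 2)" using k3 by (simp add: field_simps)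
          ultimately have "m * m powr (2 / (real k - 2)) < 2 * m" using m1 by (simp add: powr_add)
          then have "m powr (2 / (real k - 2)) \<le> 2" using m1 by simp
          then have "(m powr (2 / (real k - 2))) powr ((real k - 2) / 2) \<le> 2 powr ((real k - 2) / 2)"
            using k3 by (intro powr_mono2) auto
          also have "\<dots> \<le> 2 powr (real k)" using k3 by (intro powr_mono) auto
          finally have "m powr (2 / (real k - 2) * ((real k - 2) / 2)) \<le> 2 ^ k"
            by (simp only: powr_powr) (simp add: powr_realpow)
          moreover have "2 / (real k - 2) * ((real k - 2) / 2) = 1" using k3 by simp
          ultimately have "m powr 1 \<le> 2 ^ k" by (simp only:)
          then have "m \<le> 2 ^ k" using m1 by simp
          then have "real (nat \<bar>w\<bar>) ^ k < 2 ^ k" using wm by simp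
          then have "real (nat \<bar>w\<bar>) < 2" by (rule power_less_imp_less_base) simp
          then show ?thesis using 3 by simp
        qed
      qed
    qed
    have dvdZ: "int e dvd w ^ k - n" if wZ: "w \<in> Z" for w
    proof -
      obtain c where "c \<in> S - {e}" "w = z c" using wZ by (auto simp: Z_def)
      then show ?thesis using z[of c] by simp
    qed
    \<comment> \<open>If X >= 1, the exceptional root -1 is within the bound as well. If X < 1, only
      0 and -1 can occur, and not both: their k-th powers differ by a unit, while e >= 3.\<close>
    have "real (card Z) \<le> X + 1"
    proof (cases "\<lfloor>X\<rfloor> \<ge> 1")
      case True
      have "card (Z - {0}) \<le> nat \<lfloor>X\<rfloor>"
      proof (rule card_signed_roots_le[OF e3 dvdZ])
        show "0 \<le> w" if "even k" "w \<in> Z" for w using that znn by (auto simp: Z_def)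
        show "\<bar>w\<bar> \<le> int (nat \<lfloor>X\<rfloor>)" if "w \<in> Z" for w using sz[OF that] True by auto
      qed
      moreover have "card Z \<le> card (Z - {0}) + 1"
        using finZ by (auto simp: card_Diff_singleton_if)
      ultimately have "int (card Z) \<le> \<lfloor>X\<rfloor> + 1" using True by linarith
      then show ?thesis by linarith
    next
      case False
      then have "\<lfloor>X\<rfloor> = 0" using X0 by (simp add: floor_eq_iff)
      then have sub: "w = 0 \<or> w = -1" if "w \<in> Z" for w using sz[OF that] by auto
      have "\<not> (0 \<in> Z \<and> -1 \<in> Z)"
      proof clarify
        assume "0 \<in> Z" "-1 \<in> Z"
        then have "int e dvd ((-1) ^ k - n) - (0 ^ k - n)" by (intro dvd_diff[OF dvdZ dvdZ])
        then have "int e dvd (-1) ^ k" using k by (simp add: zero_power)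
        then have "int e dvd 1" by (simp add: minus_one_power_iff split: if_splits)
        then show False using e3 by simp
      qed
      then have "Z \<subseteq> {0} \<or> Z \<subseteq> {-1}" using sub by blast
      then have "card Z \<le> 1" 
        using card_mono[of "{0::int}" Z] card_mono[of "{-1::int}" Z] by auto
      then show ?thesis using X0 by simp
    qed
    then show ?thesis using cardZ by simp
  qed
qed

section \<open>From finite subsets to suprema\<close>

lemma set_size_le_if_card_le:
  assumes "\<And>F. finite F \<Longrightarrow> F \<subseteq> A \<Longrightarrow> card F \<le> b"
  shows "finite A" "set_size A \<le> enat b"
proof -
  show "finite A"
  proof (rule ccontr)
    assume "infinite A"
    then obtain F where "finite F" "card F = Suc b" "F \<subseteq> A"
      using infinite_arbitrarily_large by blast
    then show False using assms[of F] by simp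
  qed
  then show "set_size A \<le> enat b" using assms[of A] by (simp add: set_size_def)
qed

theorem theorem2p5:
  fixes k :: nat and L :: real and n :: int
  assumes "k \<ge> 3"
    and "real k / (2 * real k - 4) < L"
    and "L \<le> real k / (real k - 2)"
    and "n \<noteq> 0"
  shows "ereal_of_enat (M_ge k n L) \<le> ereal (T k L) \<and>
    ereal_of_enat (M k n) \<le>
      ereal ((real_of_int \<bar>n\<bar> powr (2 * L) + real_of_int n) powr (1 / real k) + T k L + 1)"
proof
  define X where "X = (real_of_int \<bar>n\<bar> powr (2 * L) + real_of_int n) powr (1 / real k)"
  have X0: "0 \<le> X" by (simp add: X_def)
  have T12: "12 \<le> T k L" using exponent_range(5) assms by blast
  define large where "large C = {c \<in> C. real_of_int \<bar>n\<bar> powr L \<le> real c}" for C :: "nat set"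
  have card_le: "real (card F) \<le> T k L - 1" if "property_D k n C" "finite F" "F \<subseteq> large C" for F C
    using card_large_elements[OF assms that(1,2)] that(3) by (auto simp: large_def)
  \<comment> \<open>The suprema are extended naturals, so the real bounds are rounded down before
    they are applied to them.\<close>
  define b where "b = nat \<lfloor>T k L - 1\<rfloor>"
  have b: "real b \<le> T k L - 1" using T12 by (simp add: b_def)
  have le_b: "card F \<le> b" if "property_D k n C" "finite F" "F \<subseteq> large C" for F C
    unfolding b_def by (rule le_nat_floor[OF card_le[OF that]])
  have "M_ge k n L \<le> enat b"
    unfolding M_ge_def
  proof (rule SUP_least)
    fix C assume "C \<in> {C. property_D k n C}"
    then show "set_size {c \<in> C. real_of_int \<bar>n\<bar> powr L \<le> real c} \<le> enat b"
      using set_size_le_if_card_le(2)[of "large C" b] le_b by (simp add: large_def)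
  qed
  then have "ereal_of_enat (M_ge k n L) \<le> ereal_of_enat (enat b)" by (simp only: ereal_of_enat_le_iff)
  also have "\<dots> \<le> ereal (T k L)" using b by simp
  finally show "ereal_of_enat (M_ge k n L) \<le> ereal (T k L)" .

  define B where "B = nat \<lfloor>X + T k L + 1\<rfloor>"
  have B: "real B \<le> X + T k L + 1" using X0 T12 by (simp add: B_def)
  have "M k n \<le> enat B"
    unfolding M_def
  proof (rule SUP_least)
    fix C assume "C \<in> {C. property_D k n C}"
    then have D: "property_D k n C" by simp
    define small where "small = {c \<in> C. real c < real_of_int \<bar>n\<bar> powr L}"
    have s: "finite small" "real (card small) \<le> X + 2"
      using card_small_elements[OF assms(1,2) D] by (simp_all add: small_def X_def)
    have l: "finite (large C)" using set_size_le_if_card_le(1)[of "large C" b] le_b[OF D] by blast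
    have C: "C = small \<union> large C" by (auto simp: small_def large_def)
    have "card C \<le> card small + card (large C)" by (subst C) (rule card_Un_le)
    then have "real (card C) \<le> X + T k L + 1" using s card_le[OF D l] by simp
    then have "card C \<le> B" unfolding B_def by (rule le_nat_floor)
    moreover have "finite C" using C s l by (metis finite_UnI)
    ultimately show "set_size C \<le> enat B" by (simp add: set_size_def)
  qed
  then have "ereal_of_enat (M k n) \<le> ereal_of_enat (enat B)" by (simp only: ereal_of_enat_le_iff)
  also have "\<dots> \<le> ereal (X + T k L + 1)" using B by simp
  finally show "ereal_of_enat (M k n) \<le>
      ereal ((real_of_int \<bar>n\<bar> powr (2 * L) + real_of_int n) powr (1 / real k) + T k L + 1)"
    by (simp add: X_def)
qed

end
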